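(* Let $N\ge 1$, $n\ge 1$, $R>0$, and let $\Omega=\{x\in\mathbb{R}^N: |x|<R\}$ be the ball of radius $R$ centered at the origin. For $1\le i\le n$ let $F_i:\overline{\Omega}\times\mathbb{R}^N\times\mathbb{S}^N(\mathbb{R})\to\mathbb{R}$ and $f_i:\overline{\Omega}\times\mathbb{R}^n\times\mathbb{R}^N\to\mathbb{R}$ satisfy conditions $(H_0)$, $(H_1)$, $(H_2)$, $(H_3)$, $(H_4)$, $(H_5)$ listed in the context, for all $1\le i\le n$. Let $u_1,\dots,u_n\in C^2(\overline{\Omega})$ satisfy, for every $1\le i\le n$, $$F_i(x,Du_i,D^2u_i)+f_i(x,u_1,\dots,u_n,Du_i)=0 \ \text{ in } \Omega,\qquad u_i>0 \ \text{ in } \Omega,\qquad u_i=0\ \text{ on } \partial\Omega .$$ Then for every $1\le i\le n$, $u_i$ is radially symmetric and $\partial_r u_i<0$ for all $r=|x|\in(0,R)$.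
   Context: $\mathbb{S}^N(\mathbb{R})$ is the space of real symmetric $N\times N$ matrices. For constants $0<\alpha_i\le\beta_i$, the Pucci extremal operators are $\mathcal{M}_i^+(X)=\sup_{\alpha_i I\le A\le\beta_i I}\mathrm{tr}(AX)$ and $\mathcal{M}_i^-(X)=\inf_{\alpha_i I\le A\le\beta_i I}\mathrm{tr}(AX)$, where $A$ ranges over symmetric matrices. Write $\mathbf{u}=(u_1,\dots,u_n)\in\mathbb{R}^n$, $p\in\mathbb{R}^N$, $X\in\mathbb{S}^N(\mathbb{R})$, and $\mathcal{F}_i(x,\mathbf{u},p,X)=F_i(x,p,X)+f_i(x,\mathbf{u},p)$. $\overline{B}_\sigma$ denotes the closed ball of radius $\sigma$ centered at $0$ (in $\mathbb{R}^N$ or $\mathbb{R}^n$ according to the variable). $(H_0)$ $\mathcal{F}_i(x,\mathbf{u},Qp,Q^tXQ)=\mathcal{F}_i(x,\mathbf{u},p,X)$ for every orthogonal $N\times N$ matrix $Q$ and all $x,\mathbf{u},p,X$. $(H_1)$ For some constants $0<\alpha_i\le\beta_i$ and $\gamma\ge 0$: $\mathcal{M}_i^-(X-Y)-\gamma|p-q|\le F_i(x,p,X)-F_i(x,q,Y)\le\mathcal{M}_i^+(X-Y)+\gamma|p-q|$ for all $X,Y\in\mathbb{S}^N(\mathbb{R})$, $p,q\in\mathbb{R}^N$, $x\in\Omega$; and $F_i(\cdot,0,0)\equiv 0$. $(H_2)$ For every $\sigma>0$ there is $\mu_\sigma\ge 0$ such that $|f_i(x,\mathbf{u},p)-f_i(x,\mathbf{u},q)|\le\mu_\sigma|p-q|$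 for all $p,q\in\overline{B}_\sigma$, $x\in\Omega$, $\mathbf{u}\in\overline{B}_\sigma$. $(H_3)$ $F_i$ and $f_i$ are radially symmetric in $x$ (they depend on $x$ only through $|x|$), and $F_i+f_i$ is nonincreasing in $r=|x|$ for each fixed $\mathbf{u},p,X$. $(H_4)$ $f_i=f_{i,1}+f_{i,2}$, where $f_{i,1}$ is uniformly locally Lipschitz in the component $u_i$, and $f_{i,2}$ is nondecreasing in $u_i$, whenever the remaining components $u_j$ ($j\ne i$) and $x,p$ are fixed. (Uniformly locally Lipschitz: for $\mathbf{u}$ and $p$ in bounded sets and $x\in\Omega$, the Lipschitz constant in $u_i$ may be chosen independent of $x$, $p$ and of the $u_j$, $j\neq i$.) $(H_5)$ For every $j\ne i$, the map $u_j\mapsto f_i(x,u_1,\dots,u_n,p)$ is nondecreasing when $x$, $p$ and all $u_l$, $l\ne j$, are fixed. *)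

theory Defs
  imports "HOL-Analysis.Analysis"
begin

section \<open>Symmetric matrices and the Pucci extremal operators\<close>

definition sym_mats :: "(real^'N^'N) set" where
  "sym_mats = {X. transpose X = X}"

definition loewner_le :: "real^'N^'N \<Rightarrow> real^'N^'N \<Rightarrow> bool" where
  "loewner_le A B \<longleftrightarrow> (\<forall>v. v \<bullet> (A *v v) \<le> v \<bullet> (B *v v))"

definition elliptic_mats :: "real \<Rightarrow> real \<Rightarrow> (real^'N^'N) set" where
  "elliptic_mats \<alpha> \<beta> =
     {A \<in> sym_mats. loewner_le (\<alpha> *\<^sub>R mat 1) A \<and> loewner_le A (\<beta> *\<^sub>R mat 1)}"

definition pucci_max :: "real \<Rightarrow> real \<Rightarrow> real^'N^'N \<Rightarrow> real" where
  "pucci_max \<alpha> \<beta> X = (SUP A\<in>elliptic_mats \<alpha> \<beta>. trace (A ** X))"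

definition pucci_min :: "real \<Rightarrow> real \<Rightarrow> real^'N^'N \<Rightarrow> real" where
  "pucci_min \<alpha> \<beta> X = (INF A\<in>elliptic_mats \<alpha> \<beta>. trace (A ** X))"

section \<open>Gradient, Hessian, twice continuous differentiability up to the boundary\<close>

definition grad :: "(real^'N \<Rightarrow> real) \<Rightarrow> real^'N \<Rightarrow> real^'N" where
  "grad u x = (\<chi> j. frechet_derivative u (at x) (axis j 1))"

lemma grad_GDERIV:
  assumes "u differentiable (at x)"
  shows "GDERIV u x :> grad u x"
proof -
  have d: "(u has_derivative frechet_derivative u (at x)) (at x)"
    using assms frechet_derivative_works by blast
  interpret linear "frechet_derivative u (at x)"
    using d has_derivative_linear by blast
  have "frechet_derivative u (at x) h = h \<bullet> grad u x" for h
  proof -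
    have "frechet_derivative u (at x) h = frechet_derivative u (at x) (\<Sum>j\<in>UNIV. h $ j *\<^sub>R axis j 1)"
      using basis_expansion[of h] by (simp add: scalar_mult_eq_scaleR)
    also have "\<dots> = h \<bullet> grad u x"
      by (simp add: sum scale grad_def inner_vec_def)
    finally show ?thesis .
  qed
  then have "frechet_derivative u (at x) = (\<lambda>h. h \<bullet> grad u x)" by blast
  with d show ?thesis by (simp add: gderiv_def)
qed

definition hessian :: "(real^'N \<Rightarrow> real) \<Rightarrow> real^'N \<Rightarrow> real^'N^'N" where
  "hessian u x = jacobian (grad u) (at x)"

text \<open>For an open set \<open>\<Omega>\<close>, \<open>C2_closure \<Omega> u\<close> says that \<open>u\<close> is of class
  \<open>C\<^sup>2\<close> on the closure of \<open>\<Omega>\<close>: its derivatives up to order two exist in \<open>\<Omega>\<close>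
  and extend continuously to the closure. Values of \<open>u\<close> outside the closure are irrelevant.\<close>

definition C2_closure :: "(real^'N) set \<Rightarrow> (real^'N \<Rightarrow> real) \<Rightarrow> bool" where
  "C2_closure \<Omega> u \<longleftrightarrow>
     continuous_on (closure \<Omega>) u \<and>
     (\<forall>x\<in>\<Omega>. u differentiable (at x)) \<and>
     (\<forall>x\<in>\<Omega>. grad u differentiable (at x)) \<and>
     (\<exists>G. continuous_on (closure \<Omega>) G \<and> (\<forall>x\<in>\<Omega>. G x = grad u x)) \<and>
     (\<exists>H. continuous_on (closure \<Omega>) H \<and> (\<forall>x\<in>\<Omega>. H x = hessian u x))"

text \<open>The radial derivative at \<open>x \<noteq> 0\<close>, i.e. the derivative of \<open>u\<close> along the ray through \<open>x\<close>
  with respect to \<open>r = norm x\<close>.\<close>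

definition radial_deriv :: "(real^'N \<Rightarrow> real) \<Rightarrow> real^'N \<Rightarrow> real" where
  "radial_deriv u x = deriv (\<lambda>r. u (r *\<^sub>R sgn x)) (norm x)"

definition radial_on :: "'a::real_normed_vector set \<Rightarrow> ('a \<Rightarrow> 'b) \<Rightarrow> bool" where
  "radial_on S g \<longleftrightarrow> (\<forall>x\<in>S. \<forall>y\<in>S. norm x = norm y \<longrightarrow> g x = g y)"

section \<open>Structure conditions on the nonlinearities\<close>

text \<open>The functions below are total, but only their restrictions to arguments
  \<open>x \<in> closure \<Omega>\<close> and \<open>X \<in> sym_mats\<close> are constrained. The type \<open>'n\<close> indexes the equations
  and unknowns, and \<open>'N\<close> the coordinates of space.\<close>

type_synonym 'N second_order = "real^'N \<Rightarrow> real^'N \<Rightarrow> real^'N^'N \<Rightarrow> real"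
type_synonym ('n, 'N) first_order = "real^'N \<Rightarrow> real^'n \<Rightarrow> real^'N \<Rightarrow> real"

text \<open>Here \<open>p\<close> is sent to \<open>Q *v p\<close> but \<open>X\<close> to \<open>transpose Q ** X ** Q\<close>. For symmetric \<open>Q\<close>,
  such as reflections, this is the usual action \<open>(Q *v p, Q ** X ** transpose Q)\<close>; for other
  orthogonal matrices it is not.\<close>

definition orthogonally_invariant ::
    "(real^'N) set \<Rightarrow> 'N second_order \<Rightarrow> ('n::finite, 'N) first_order \<Rightarrow> bool" where
  "orthogonally_invariant \<Omega> F f \<longleftrightarrow>
     (\<forall>Q. orthogonal_matrix Q \<longrightarrow>
       (\<forall>x\<in>closure \<Omega>. \<forall>u p. \<forall>X\<in>sym_mats.
         F x (Q *v p) (transpose Q ** X ** Q) + f x u (Q *v p) = F x p X + f x u p))"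

definition uniformly_elliptic ::
    "(real^'N) set \<Rightarrow> real \<Rightarrow> real \<Rightarrow> real \<Rightarrow> 'N second_order \<Rightarrow> bool" where
  "uniformly_elliptic \<Omega> \<alpha> \<beta> \<gamma> F \<longleftrightarrow>
     (\<forall>X\<in>sym_mats. \<forall>Y\<in>sym_mats. \<forall>p q. \<forall>x\<in>\<Omega>.
        pucci_min \<alpha> \<beta> (X - Y) - \<gamma> * norm (p - q) \<le> F x p X - F x q Y \<and>
        F x p X - F x q Y \<le> pucci_max \<alpha> \<beta> (X - Y) + \<gamma> * norm (p - q)) \<and>
     (\<forall>x\<in>closure \<Omega>. F x 0 0 = 0)"

definition locally_lipschitz_in_gradient ::
    "(real^'N) set \<Rightarrow> ('n::finite, 'N) first_order \<Rightarrow> bool" where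
  "locally_lipschitz_in_gradient \<Omega> f \<longleftrightarrow>
     (\<forall>\<sigma>>0. \<exists>\<mu>\<ge>0. \<forall>p\<in>cball 0 \<sigma>. \<forall>q\<in>cball 0 \<sigma>. \<forall>x\<in>\<Omega>. \<forall>u\<in>cball 0 \<sigma>.
        \<bar>f x u p - f x u q\<bar> \<le> \<mu> * norm (p - q))"

definition radially_nonincreasing ::
    "(real^'N) set \<Rightarrow> 'N second_order \<Rightarrow> ('n::finite, 'N) first_order \<Rightarrow> bool" where
  "radially_nonincreasing \<Omega> F f \<longleftrightarrow>
     (\<forall>p. \<forall>X\<in>sym_mats. radial_on (closure \<Omega>) (\<lambda>x. F x p X)) \<and>
     (\<forall>u p. radial_on (closure \<Omega>) (\<lambda>x. f x u p)) \<and>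
     (\<forall>u p. \<forall>X\<in>sym_mats. \<forall>x\<in>closure \<Omega>. \<forall>y\<in>closure \<Omega>.
        norm x \<le> norm y \<longrightarrow> F y p X + f y u p \<le> F x p X + f x u p)"

definition uniformly_locally_lipschitz_in ::
    "'n::finite \<Rightarrow> (real^'N) set \<Rightarrow> ('n, 'N) first_order \<Rightarrow> bool" where
  "uniformly_locally_lipschitz_in i \<Omega> g \<longleftrightarrow>
     (\<forall>U P. bounded U \<longrightarrow> bounded P \<longrightarrow>
       (\<exists>L\<ge>0. \<forall>x\<in>\<Omega>. \<forall>p\<in>P. \<forall>u\<in>U. \<forall>v\<in>U. (\<forall>j. j \<noteq> i \<longrightarrow> u $ j = v $ j) \<longrightarrow>
          \<bar>g x u p - g x v p\<bar> \<le> L * \<bar>u $ i - v $ i\<bar>))"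

definition nondecreasing_in ::
    "'n::finite \<Rightarrow> (real^'N) set \<Rightarrow> ('n, 'N) first_order \<Rightarrow> bool" where
  "nondecreasing_in j \<Omega> g \<longleftrightarrow>
     (\<forall>x\<in>closure \<Omega>. \<forall>p u v. (\<forall>l. l \<noteq> j \<longrightarrow> u $ l = v $ l) \<longrightarrow> u $ j \<le> v $ j \<longrightarrow>
        g x u p \<le> g x v p)"

definition lipschitz_plus_nondecreasing_in ::
    "'n::finite \<Rightarrow> (real^'N) set \<Rightarrow> ('n, 'N) first_order \<Rightarrow> bool" where
  "lipschitz_plus_nondecreasing_in i \<Omega> f \<longleftrightarrow>
     (\<exists>f1 f2. (\<forall>x\<in>closure \<Omega>. \<forall>u p. f x u p = f1 x u p + f2 x u p) \<and>
        uniformly_locally_lipschitz_in i \<Omega> f1 \<and> nondecreasing_in i \<Omega> f2)"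

end

theory Submission
  imports Defs
begin

text \<open>The proof is the moving plane method of Gidas, Ni and Nirenberg. For a unit vector \<open>e\<close> and
  \<open>l > 0\<close>, let \<open>w\<close> be the difference between the reflection of \<open>u\<close> in the hyperplane
  \<open>x \<bullet> e = l\<close> and \<open>u\<close>. If every component of \<open>w\<close> is nonnegative on the cap \<open>x \<bullet> e > l\<close>, then
  each one is a supersolution of a linear inequality for the minimal Pucci operator there, and the
  strong maximum principle and the Hopf lemma give \<open>w > 0\<close> in the cap and \<open>\<partial>\<^sub>e u < 0\<close> on the
  hyperplane. Because the monotone part of \<open>f\<close> may be discontinuous, no maximum principle in thin
  caps is available. Instead, the planes are started and continued with the fact that \<open>\<partial>\<^sub>e u < 0\<close>
  near every boundary point \<open>b\<close> with \<open>b \<bullet> e > 0\<close>: this holds if the gradient of \<open>u\<close> or its Hessian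
  is nonzero at \<open>b\<close>, and if both vanished, the Hopf lemma for \<open>u\<close> at \<open>b\<close> would be violated.\<close>

section \<open>Positive semidefinite matrices and the Pucci operators\<close>

text \<open>The part of \<open>f i\<close> that is nondecreasing in \<open>u i\<close> may jump
  upwards, so increments of \<open>f i\<close> are controlled from one side only. A difference of
  two ordered solutions satisfies a linear differential inequality, but where the order fails no
  inequality is available at all. Hence every maximum principle below is stated for functions
  already known to be nonnegative, and a sign can only be propagated, never created. At the sphere a
  second obstacle appears: near it the nonlinearity may be negative, so the Hopf lemma does not
  apply to \<open>u i\<close> directly. It is needed, however, only at points where gradient and
  Hessian vanish, and there the equation itself supplies the missing sign. At all other boundary
  points elementary calculus is enough: \<open>u i\<close> vanishes on the sphere and is positive
  inside, so the first nonvanishing derivative in an inward direction is positive, and either case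
  makes the derivative along \<open>e\<close> negative nearby.\<close>

definition outer :: "real^'N \<Rightarrow> real^'N^'N" where
  "outer v = (\<chi> i j. v $ i * v $ j)"

lemma outer_mult_vec: "outer v *v w = (v \<bullet> w) *\<^sub>R v"
  by (simp add: outer_def vec_eq_iff matrix_vector_mult_def inner_vec_def sum_distrib_left
      sum_distrib_right mult_ac)

lemma inner_outer: "w \<bullet> (outer v *v w) = (v \<bullet> w)\<^sup>2"
  by (simp add: outer_mult_vec inner_commute power2_eq_square)

lemma trace_mult_outer: "trace (A ** outer v) = v \<bullet> (A *v v)"
  by (simp add: trace_def outer_def matrix_matrix_mult_def matrix_vector_mult_def inner_vec_def
      sum_distrib_left mult_ac)

lemma trace_outer_mult: "trace (outer v ** A) = v \<bullet> (A *v v)"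
  by (metis trace_mul_sym trace_mult_outer)

lemma trace_mult_diff: "trace (A ** (X - Y)) = trace (A ** X) - trace (A ** Y)"
  for A :: "real^'N^'N"
  by (simp add: trace_def matrix_matrix_mult_def right_diff_distrib sum_subtractf)

lemma trace_diff_mult: "trace ((X - Y) ** A) = trace (X ** A) - trace (Y ** A)"
  for A :: "real^'N^'N"
  by (simp add: trace_def matrix_matrix_mult_def left_diff_distrib sum_subtractf)

lemma trace_scaleR: "trace (c *\<^sub>R A) = c * trace A" for A :: "real^'N^'N"
  by (simp add: trace_def sum_distrib_left)

lemma matrix_mult_scaleR: "A ** (c *\<^sub>R B) = c *\<^sub>R (A ** B)" for A :: "real^'N^'M"
  by (simp add: vec_eq_iff matrix_matrix_mult_def sum_distrib_left mult_ac)

lemma scaleR_matrix_mult: "(c *\<^sub>R A) ** B = c *\<^sub>R (A ** B)" for A :: "real^'N^'M"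
  by (simp add: vec_eq_iff matrix_matrix_mult_def sum_distrib_left mult_ac)

lemma inner_symmetric_matrix:
  fixes A :: "real^'N^'N"
  assumes "transpose A = A"
  shows "v \<bullet> (A *v w) = w \<bullet> (A *v v)"
  by (metis assms dot_lmul_matrix inner_commute transpose_matrix_vector)

text \<open>Both mixed terms are kept because the identity is also applied to the extended Hessian
  at a boundary point, before its symmetry there is known.\<close>

lemma quadratic_form_combination:
  fixes A :: "real^'N^'N"
  shows "(a *\<^sub>R v + b *\<^sub>R w) \<bullet> (A *v (a *\<^sub>R v + b *\<^sub>R w)) =
    a * a * (v \<bullet> (A *v v)) + a * b * (v \<bullet> (A *v w) + w \<bullet> (A *v v)) + b * b * (w \<bullet> (A *v w))"
  by (simp add: matrix_vector_right_distrib matrix_vector_mult_scaleR inner_add_left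
      inner_add_right algebra_simps)

lemma quadratic_form_minus: "(- v) \<bullet> (A *v (- v)) = v \<bullet> (A *v v)" for A :: "real^'N^'N"
  using quadratic_form_combination[of "-1" v 0 0 A] by simp

lemma axis_inner_matrix: "axis k 1 \<bullet> (A *v v) = (A $ k) \<bullet> v" for A :: "real^'N^'N"
  by (simp add: inner_axis' matrix_vector_mul_component)

lemma axis_matrix_axis: "axis k 1 \<bullet> (A *v axis j 1) = A $ k $ j" for A :: "real^'N^'N"
  by (simp add: inner_axis' matrix_vector_mult_basis column_def)

text \<open>By induction on the support of \<open>A\<close>: subtracting \<open>A e e\<^sup>T A / (e\<^sup>T A e)\<close> for a basis
  vector \<open>e\<close> keeps \<open>A\<close> positive semidefinite and kills a row.\<close>

lemma trace_mult_psd_nonneg: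
  fixes A Z :: "real^'N^'N"
  assumes "transpose A = A" and "\<And>v. 0 \<le> v \<bullet> (A *v v)" and Z: "\<And>v. 0 \<le> v \<bullet> (Z *v v)"
  shows "0 \<le> trace (A ** Z)"
proof -
  have "0 \<le> trace (A ** Z)"
    if "finite S" "transpose A = A" "\<And>v. 0 \<le> v \<bullet> (A *v v)" "\<And>i. i \<notin> S \<Longrightarrow> A $ i = 0"
    for S :: "'N set" and A
    using that
  proof (induction S arbitrary: A)
    case empty
    then have "A = 0" by (simp add: vec_eq_iff)
    then show ?case by (simp add: trace_def)
  next
    case (insert k S)
    have sym: "A $ i $ j = A $ j $ i" for i j
      by (metis insert.prems(1) transpose_def vec_lambda_beta)
    have ss: "v \<bullet> (A *v w) = w \<bullet> (A *v v)" for v w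
      using inner_symmetric_matrix insert.prems(1) by blast
    show ?case
    proof (cases "A $ k $ k = 0")
      case True
      have "A $ k $ j = 0" for j
      proof (rule ccontr)
        assume nz: "A $ k $ j \<noteq> 0"
        \<comment> \<open>With a zero diagonal entry the form is affine in \<open>t\<close>; this
          \<open>t\<close> gives it the value -1.\<close>
        define t where "t = - (A $ j $ j + 1) / (2 * A $ k $ j)"
        have "0 \<le> (t *\<^sub>R axis k 1 + axis j 1) \<bullet> (A *v (t *\<^sub>R axis k 1 + axis j 1))"
          by (rule insert.prems(2))
        also have "\<dots> = t * t * A $ k $ k + 2 * t * A $ k $ j + A $ j $ j"
          using sym[of j k]
          by (simp add: matrix_vector_right_distrib matrix_vector_mult_scaleR inner_add_left
              inner_add_right axis_matrix_axis algebra_simps)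
        also have "\<dots> = -1"
          using True nz by (simp add: t_def field_simps)
        finally show False by simp
      qed
      then have "A $ k = 0" by (simp add: vec_eq_iff)
      then have "A $ i = 0" if "i \<notin> S" for i
        using insert.prems(3) that by (cases "i = k") auto
      then show ?thesis using insert.IH insert.prems by blast
    next
      case False
      define c where "c = A $ k $ k"
      define a where "a = A $ k"
      have "0 \<le> c"
        using insert.prems(2)[of "axis k 1"] by (simp add: c_def axis_matrix_axis)
      then have c: "c > 0" using False c_def by simp
      define B where "B = A - (1 / c) *\<^sub>R outer a"
      have "transpose B = B"
        using sym by (simp add: B_def outer_def transpose_def vec_eq_iff mult.commute)
      moreover have "0 \<le> v \<bullet> (B *v v)" for v
      proof -
        \<comment> \<open>This \<open>s\<close> minimises the form of \<open>A\<close> on the line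
          through \<open>v\<close> in direction \<open>axis k 1\<close>; the minimum is the Schur
          complement form, that is, the form of \<open>B\<close> at \<open>v\<close>.\<close>
        define s where "s = (a \<bullet> v) / c"
        have "0 \<le> (v - s *\<^sub>R axis k 1) \<bullet> (A *v (v - s *\<^sub>R axis k 1))"
          by (rule insert.prems(2))
        also have "\<dots> = v \<bullet> (A *v v) - 2 * s * (a \<bullet> v) + s * s * c"
          using ss[of v "axis k 1"]
          by (simp add: matrix_vector_mult_diff_distrib matrix_vector_mult_scaleR inner_diff_left
              inner_diff_right axis_matrix_axis axis_inner_matrix inner_axis c_def a_def algebra_simps)
        also have "\<dots> = v \<bullet> (B *v v)"
          using c by (simp add: B_def s_def matrix_vector_mult_diff_rdistrib scaleR_matrix_vector_assoc[symmetric]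
              inner_diff_right inner_outer field_simps power2_eq_square)
        finally show ?thesis .
      qed
      moreover have "B $ i = 0" if "i \<notin> S" for i
      proof (cases "i = k")
        case True
        then show ?thesis using c by (simp add: B_def outer_def vec_eq_iff a_def c_def)
      next
        case False
        then have "A $ i = 0" using that insert.prems(3) by blast
        moreover have "a $ i = 0"
          using sym[of k i] calculation by (simp add: a_def)
        ultimately show ?thesis by (simp add: B_def outer_def vec_eq_iff)
      qed
      ultimately have "0 \<le> trace (B ** Z)" using insert.IH by blast
      moreover have "trace (A ** Z) = trace (B ** Z) + (1 / c) * (a \<bullet> (Z *v a))"
        by (simp add: B_def trace_diff_mult scaleR_matrix_mult trace_scaleR
            trace_outer_mult)
      ultimately show ?thesis using Z[of a] c by simp
    qed
  qed
  from this[of UNIV A] show ?thesis using assms by simp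
qed

lemma elliptic_matsD:
  assumes "A \<in> elliptic_mats \<alpha> \<beta>"
  shows "transpose A = A" "\<alpha> * (v \<bullet> v) \<le> v \<bullet> (A *v v)" "v \<bullet> (A *v v) \<le> \<beta> * (v \<bullet> v)"
  using assms by (auto simp: elliptic_mats_def sym_mats_def loewner_le_def scaleR_matrix_vector_assoc[symmetric])

lemma elliptic_mats_nonempty:
  assumes "\<alpha> \<le> \<beta>"
  shows "elliptic_mats \<alpha> \<beta> \<noteq> ({} :: (real^'N^'N) set)"
proof -
  have "\<alpha> *\<^sub>R mat 1 \<in> (elliptic_mats \<alpha> \<beta> :: (real^'N^'N) set)"
    using assms
    by (auto simp: elliptic_mats_def sym_mats_def loewner_le_def scaleR_matrix_vector_assoc[symmetric]
        transpose_scalar mult_right_mono)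
  then show ?thesis by blast
qed

lemma trace_elliptic_le:
  fixes A :: "real^'N^'N" and \<alpha> \<beta> :: real
  assumes "A \<in> elliptic_mats \<alpha> \<beta>"
  shows "trace A \<le> CARD('N) * \<beta>"
proof -
  have "A $ i $ i \<le> \<beta>" for i
    using elliptic_matsD(3)[OF assms, of "axis i 1"] by (simp add: axis_matrix_axis inner_axis_axis)
  then have "trace A \<le> (\<Sum>i\<in>(UNIV :: 'N set). \<beta>)"
    unfolding trace_def by (intro sum_mono) auto
  then show ?thesis by simp
qed

text \<open>Positive semidefiniteness, tested on the sum and the difference of two basis vectors,
  bounds an off-diagonal entry by the mean of the two diagonal ones.\<close>

lemma abs_elliptic_entry_le:
  fixes A :: "real^'N^'N"
  assumes A: "A \<in> elliptic_mats \<alpha> \<beta>" and "0 < \<alpha>"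
  shows "\<bar>A $ i $ j\<bar> \<le> \<beta>"
proof -
  have sym: "A $ j $ i = A $ i $ j"
    by (metis elliptic_matsD(1)[OF A] transpose_def vec_lambda_beta)
  have nn: "0 \<le> v \<bullet> (A *v v)" for v
    using elliptic_matsD(2)[OF A, of v] \<open>0 < \<alpha>\<close> by (smt (verit) inner_ge_zero mult_nonneg_nonneg)
  have d: "A $ i $ i \<le> \<beta>" for i
    using elliptic_matsD(3)[OF A, of "axis i 1"] by (simp add: axis_matrix_axis inner_axis_axis)
  have "0 \<le> A $ i $ i + 2 * A $ i $ j + A $ j $ j"
    using nn[of "axis i 1 + axis j 1"] sym
    by (simp add: matrix_vector_right_distrib inner_add_left inner_add_right axis_matrix_axis)
  moreover have "0 \<le> A $ i $ i - 2 * A $ i $ j + A $ j $ j"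
    using nn[of "axis i 1 - axis j 1"] sym
    by (simp add: matrix_vector_mult_diff_distrib inner_diff_left inner_diff_right axis_matrix_axis)
  ultimately show ?thesis using d[of i] d[of j] by linarith
qed

text \<open>A crude entrywise bound suffices: it only serves to dominate \<open>F\<close> by a
  quantity that tends to zero together with gradient and Hessian.\<close>

lemma pucci_max_le:
  fixes X :: "real^'N^'N" and \<alpha> \<beta> :: real
  assumes "0 < \<alpha>" "\<alpha> \<le> \<beta>"
  shows "pucci_max \<alpha> \<beta> X \<le> (CARD('N) * CARD('N) * \<beta>) * norm X"
  unfolding pucci_max_def
proof (rule cSUP_least)
  show "elliptic_mats \<alpha> \<beta> \<noteq> ({} :: (real^'N^'N) set)"
    using elliptic_mats_nonempty assms by blast
next
  fix A :: "real^'N^'N"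
  assume A: "A \<in> elliptic_mats \<alpha> \<beta>"
  have "\<beta> > 0" using assms by linarith
  have "A $ i $ k * X $ k $ i \<le> \<beta> * norm X" for i k
  proof -
    have "\<bar>X $ k $ i\<bar> \<le> norm X"
      using component_le_norm_cart[of "X $ k" i] Finite_Cartesian_Product.norm_nth_le[of X k]
      by linarith
    then have "\<bar>A $ i $ k\<bar> * \<bar>X $ k $ i\<bar> \<le> \<beta> * norm X"
      using abs_elliptic_entry_le[OF A] assms by (intro mult_mono) auto
    then show ?thesis by (metis abs_ge_self abs_mult order_trans)
  qed
  then have "trace (A ** X) \<le> (\<Sum>i\<in>(UNIV :: 'N set). \<Sum>k\<in>(UNIV :: 'N set). \<beta> * norm X)"
    unfolding trace_def matrix_matrix_mult_def vec_lambda_beta by (intro sum_mono)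
  then show "trace (A ** X) \<le> (CARD('N) * CARD('N) * \<beta>) * norm X"
    by (simp add: mult_ac)
qed

lemma pucci_min_ge:
  assumes "\<alpha> \<le> \<beta>" "\<And>A. A \<in> elliptic_mats \<alpha> \<beta> \<Longrightarrow> c \<le> trace (A ** X)"
  shows "c \<le> pucci_min \<alpha> \<beta> X"
  unfolding pucci_min_def using assms elliptic_mats_nonempty by (intro cINF_greatest) auto

section \<open>Twice differentiable functions\<close>

text \<open>Gradient and Hessian are explicit arguments, so that reflections, differences and
  barriers carry theirs along, and continuous extensions can replace \<open>grad\<close> and
  \<open>hessian\<close>. Only differentiability is asked, not continuity of
  \<open>H\<close>.\<close>

definition twice_diff ::
    "(real^'N) set \<Rightarrow> (real^'N \<Rightarrow> real) \<Rightarrow> (real^'N \<Rightarrow> real^'N) \<Rightarrow> (real^'N \<Rightarrow> real^'N^'N) \<Rightarrow> bool" where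
  "twice_diff S w g H \<longleftrightarrow>
     (\<forall>x\<in>S. (w has_derivative (\<lambda>h. g x \<bullet> h)) (at x) \<and> (g has_derivative (\<lambda>h. H x *v h)) (at x))"

lemma twice_diffD:
  assumes "twice_diff S w g H" "x \<in> S"
  shows "(w has_derivative (\<lambda>h. g x \<bullet> h)) (at x)" "(g has_derivative (\<lambda>h. H x *v h)) (at x)"
  using assms by (auto simp: twice_diff_def)

lemma twice_diff_subset: "twice_diff S w g H \<Longrightarrow> T \<subseteq> S \<Longrightarrow> twice_diff T w g H"
  by (auto simp: twice_diff_def)

lemma twice_diff_continuous_on: "twice_diff S w g H \<Longrightarrow> continuous_on S w"
  by (metis continuous_at_imp_continuous_on has_derivative_continuous twice_diffD(1))

lemma twice_diff_diff_scaled: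
  assumes "twice_diff S w g H" "twice_diff S v g' H'"
  shows "twice_diff S (\<lambda>x. w x - c * v x) (\<lambda>x. g x - c *\<^sub>R g' x) (\<lambda>x. H x - c *\<^sub>R H' x)"
  unfolding twice_diff_def
proof (intro ballI conjI)
  fix x assume x: "x \<in> S"
  show "((\<lambda>x. w x - c * v x) has_derivative (\<lambda>h. (g x - c *\<^sub>R g' x) \<bullet> h)) (at x)"
    using twice_diffD[OF assms(1) x] twice_diffD[OF assms(2) x]
    by (auto intro!: derivative_eq_intros simp: inner_diff_left)
  show "((\<lambda>x. g x - c *\<^sub>R g' x) has_derivative (*v) (H x - c *\<^sub>R H' x)) (at x)"
    using twice_diffD[OF assms(1) x] twice_diffD[OF assms(2) x]
    by (auto intro!: derivative_eq_intros simp: matrix_vector_mult_diff_rdistrib scaleR_matrix_vector_assoc[symmetric])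
qed

text \<open>The chain rule produces \<open>transpose Q\<close> on the left. For symmetric
  \<open>Q\<close>, such as a reflection, the result is the pair of gradient and Hessian to which
  \<open>orthogonally_invariant\<close> applies.\<close>

lemma twice_diff_affine:
  assumes "twice_diff S w g H" "transpose Q = Q"
  shows "twice_diff {x. Q *v x + c \<in> S} (\<lambda>x. w (Q *v x + c)) (\<lambda>x. Q *v g (Q *v x + c))
    (\<lambda>x. Q ** H (Q *v x + c) ** Q)"
  unfolding twice_diff_def
proof (intro ballI conjI)
  fix x assume "x \<in> {x. Q *v x + c \<in> S}"
  then have x: "Q *v x + c \<in> S" by simp
  have Q: "(Q *v p) \<bullet> q = p \<bullet> (Q *v q)" for p q
    using inner_symmetric_matrix[OF assms(2)] by (metis inner_commute)
  have lin: "((\<lambda>x. Q *v x + c) has_derivative (\<lambda>h. Q *v h)) (at x)"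
    by (auto intro!: derivative_eq_intros bounded_linear_imp_has_derivative
        matrix_vector_mul_bounded_linear)
  show "((\<lambda>x. w (Q *v x + c)) has_derivative (\<lambda>h. (Q *v g (Q *v x + c)) \<bullet> h)) (at x)"
    using has_derivative_compose[OF lin twice_diffD(1)[OF assms(1) x]] by (simp add: Q)
  have "((\<lambda>x. Q *v g (Q *v x + c)) has_derivative (\<lambda>h. Q *v (H (Q *v x + c) *v (Q *v h)))) (at x)"
    using has_derivative_compose[OF lin twice_diffD(2)[OF assms(1) x]]
    by (rule bounded_linear.has_derivative[OF matrix_vector_mul_bounded_linear])
  then show "((\<lambda>x. Q *v g (Q *v x + c)) has_derivative (*v) (Q ** H (Q *v x + c) ** Q)) (at x)"
    by (simp add: matrix_vector_mul_assoc matrix_mul_assoc)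
qed

lemma twice_diff_line:
  assumes "twice_diff S w g H" "x + t *\<^sub>R v \<in> S"
  shows "((\<lambda>s. w (x + s *\<^sub>R v)) has_real_derivative g (x + t *\<^sub>R v) \<bullet> v) (at t)"
    and "((\<lambda>s. g (x + s *\<^sub>R v) \<bullet> v') has_real_derivative v' \<bullet> (H (x + t *\<^sub>R v) *v v)) (at t)"
proof -
  have lin: "((\<lambda>s. x + s *\<^sub>R v) has_derivative (\<lambda>s. s *\<^sub>R v)) (at t)"
    by (auto intro!: derivative_eq_intros)
  have "((\<lambda>s. w (x + s *\<^sub>R v)) has_derivative (\<lambda>s. g (x + t *\<^sub>R v) \<bullet> (s *\<^sub>R v))) (at t)"
    using has_derivative_compose[OF lin twice_diffD(1)[OF assms]] .
  then show "((\<lambda>s. w (x + s *\<^sub>R v)) has_real_derivative g (x + t *\<^sub>R v) \<bullet> v) (at t)"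
    by (simp add: has_field_derivative_def mult_commute_abs)
  have "((\<lambda>s. g (x + s *\<^sub>R v) \<bullet> v') has_derivative (\<lambda>s. (H (x + t *\<^sub>R v) *v (s *\<^sub>R v)) \<bullet> v')) (at t)"
    using has_derivative_compose[OF lin twice_diffD(2)[OF assms]]
    by (auto intro!: derivative_eq_intros)
  then show "((\<lambda>s. g (x + s *\<^sub>R v) \<bullet> v') has_real_derivative v' \<bullet> (H (x + t *\<^sub>R v) *v v)) (at t)"
    by (simp add: has_field_derivative_def mult_commute_abs matrix_vector_mult_scaleR inner_commute)
qed

lemma ray_in_open:
  fixes x v :: "'a::real_normed_vector"
  assumes "open S" "x \<in> S"
  shows "\<exists>d>0. \<forall>s. \<bar>s\<bar> < d \<longrightarrow> x + s *\<^sub>R v \<in> S"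
proof -
  have "((\<lambda>s. x + s *\<^sub>R v) \<longlongrightarrow> x + 0 *\<^sub>R v) (at 0)"
    by (intro tendsto_intros)
  then have "eventually (\<lambda>s. x + s *\<^sub>R v \<in> S) (at 0)"
    using assms topological_tendstoD by fastforce
  then obtain d where "d > 0" "\<And>s. s \<noteq> 0 \<Longrightarrow> \<bar>s\<bar> < d \<Longrightarrow> x + s *\<^sub>R v \<in> S"
    unfolding eventually_at by (auto simp: dist_real_def)
  then show ?thesis using assms by (metis add.right_neutral scaleR_zero_left)
qed

text \<open>Since \<open>H\<close> need not be continuous, the second-order part uses only
  differentiability of the gradient at \<open>z\<close>: a negative form would make the derivative
  along \<open>v\<close> negative just after \<open>z\<close>, and the mean value theorem would give
  a smaller value there.\<close>

lemma local_min_second_order: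
  assumes "open S" "z \<in> S" "twice_diff S w g H" and min: "\<And>x. x \<in> S \<Longrightarrow> w z \<le> w x"
  shows "g z = 0" "0 \<le> v \<bullet> (H z *v v)"
proof -
  have "(\<lambda>h. g z \<bullet> h) = (\<lambda>h. 0)"
    using differential_zero_maxmin[OF \<open>z \<in> S\<close> \<open>open S\<close> twice_diffD(1)[OF assms(3,2)]] min by blast
  then show g0: "g z = 0" by (metis inner_eq_zero_iff)
  show "0 \<le> v \<bullet> (H z *v v)"
  proof (rule ccontr)
    assume "\<not> 0 \<le> v \<bullet> (H z *v v)"
    moreover have "((\<lambda>s. g (z + s *\<^sub>R v) \<bullet> v) has_real_derivative v \<bullet> (H z *v v)) (at 0)"
      using twice_diff_line(2)[OF assms(3), of z 0 v v] assms(2) by simp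
    ultimately obtain d where d: "d > 0" "\<And>h. h > 0 \<Longrightarrow> h < d \<Longrightarrow> g (z + h *\<^sub>R v) \<bullet> v < 0"
      using DERIV_neg_dec_right[of "\<lambda>s. g (z + s *\<^sub>R v) \<bullet> v" _ 0] g0 by force
    obtain d' where d': "d' > 0" "\<And>s. \<bar>s\<bar> < d' \<Longrightarrow> z + s *\<^sub>R v \<in> S"
      using ray_in_open assms by metis
    define t where "t = min d d' / 2"
    have t: "t > 0" "t < d" "t < d'" using d d' by (auto simp: t_def)
    have "\<exists>s. 0 < s \<and> s < t \<and>
      w (z + t *\<^sub>R v) - w (z + 0 *\<^sub>R v) = (t - 0) * (g (z + s *\<^sub>R v) \<bullet> v)"
      using t d' by (intro MVT2 twice_diff_line(1)[OF assms(3)]) auto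
    then obtain s where s: "0 < s" "s < t" "w (z + t *\<^sub>R v) - w z = t * (g (z + s *\<^sub>R v) \<bullet> v)"
      by auto
    have "g (z + s *\<^sub>R v) \<bullet> v < 0" using d s t by auto
    then have "w (z + t *\<^sub>R v) < w z" using s t by (smt (verit) mult_pos_neg)
    moreover have "z + t *\<^sub>R v \<in> S" using d' t by simp
    ultimately show False using min by fastforce
  qed
qed

text \<open>The second difference over the parallelogram spanned by \<open>t *\<^sub>R a\<close> and
  \<open>t *\<^sub>R b\<close> is symmetric in \<open>a\<close> and \<open>b\<close>; approximating
  it up to a small multiple of \<open>t\<^sup>2\<close> therefore yields symmetry of second
  derivatives without their continuity.\<close>

lemma second_difference_estimate:
  assumes "open S" "x \<in> S" "twice_diff S w g H" "\<epsilon> > 0"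
  shows "\<exists>d>0. \<forall>t. 0 < t \<and> t < d \<longrightarrow>
    \<bar>(w (x + t *\<^sub>R a + t *\<^sub>R b) - w (x + t *\<^sub>R a) - w (x + t *\<^sub>R b) + w x) - t\<^sup>2 * (a \<bullet> (H x *v b))\<bar>
      \<le> 2 * \<epsilon> * (norm a + norm b)\<^sup>2 * t\<^sup>2"
proof -
  obtain \<delta>1 where \<delta>1: "\<delta>1 > 0" "\<And>y. norm (y - x) < \<delta>1 \<Longrightarrow>
      norm (g y - g x - H x *v (y - x)) \<le> \<epsilon> * norm (y - x)"
    using twice_diffD(2)[OF assms(3,2)] \<open>\<epsilon> > 0\<close> unfolding has_derivative_at_alt by blast
  obtain \<delta>2 where \<delta>2: "\<delta>2 > 0" "ball x \<delta>2 \<subseteq> S"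
    using assms openE by blast
  define \<delta> where "\<delta> = min \<delta>1 \<delta>2"
  define m where "m = norm a + norm b"
  have "m \<ge> 0" by (simp add: m_def)
  have "\<bar>(w (x + t *\<^sub>R a + t *\<^sub>R b) - w (x + t *\<^sub>R a) - w (x + t *\<^sub>R b) + w x) - t\<^sup>2 * (a \<bullet> (H x *v b))\<bar>
      \<le> 2 * \<epsilon> * m\<^sup>2 * t\<^sup>2" if t: "0 < t" "t < \<delta> / (m + 1)" for t
  proof -
    have tm: "t * m < \<delta>"
      using t \<open>m \<ge> 0\<close> by (simp add: field_simps) 
    have n1: "norm (s *\<^sub>R a + t *\<^sub>R b) \<le> t * m" if "0 \<le> s" "s \<le> t" for s
      using that t norm_triangle_ineq[of "s *\<^sub>R a" "t *\<^sub>R b"] mult_right_mono[of s t "norm a"]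
      by (simp add: m_def algebra_simps)
    have n2: "norm (s *\<^sub>R a) \<le> t * m" if "0 \<le> s" "s \<le> t" for s
      using that t mult_mono[of s t "norm a" m] by (simp add: m_def)
    have near: "x + v \<in> S" if "norm v < \<delta>2" for v
      using \<delta>2(2) that by (intro subsetD[OF \<delta>2(2)]) (simp add: dist_norm)
    have inS: "x + s *\<^sub>R a + t *\<^sub>R b \<in> S" "x + s *\<^sub>R a \<in> S" if "0 \<le> s" "s \<le> t" for s
      using n1[OF that] n2[OF that] tm near unfolding \<delta>_def add.assoc by auto
    \<comment> \<open>The mean value theorem is applied to the difference of \<open>w\<close> along
      two parallel sides. One gradient difference remains, and both of its terms are expanded at
      \<open>x\<close>.\<close>
    have "\<exists>s. 0 < s \<and> s < t \<and>
      (w ((x + t *\<^sub>R b) + t *\<^sub>R a) - w (x + t *\<^sub>R a)) - (w ((x + t *\<^sub>R b) + 0 *\<^sub>R a) - w (x + 0 *\<^sub>R a)) =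
        (t - 0) * (g ((x + t *\<^sub>R b) + s *\<^sub>R a) \<bullet> a - g (x + s *\<^sub>R a) \<bullet> a)"
      using t inS
      by (intro MVT2 DERIV_diff twice_diff_line(1)[OF assms(3)]) (auto simp: algebra_simps)
    then obtain s where s: "0 < s" "s < t"
      "w (x + t *\<^sub>R a + t *\<^sub>R b) - w (x + t *\<^sub>R a) - w (x + t *\<^sub>R b) + w x
        = t * ((g (x + s *\<^sub>R a + t *\<^sub>R b) - g (x + s *\<^sub>R a)) \<bullet> a)"
      by (auto simp: algebra_simps)
    let ?r1 = "g (x + s *\<^sub>R a + t *\<^sub>R b) - g x - H x *v (s *\<^sub>R a + t *\<^sub>R b)"
    let ?r2 = "g (x + s *\<^sub>R a) - g x - H x *v (s *\<^sub>R a)"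
    have "norm ?r1 \<le> \<epsilon> * norm (s *\<^sub>R a + t *\<^sub>R b)"
      using \<delta>1(2)[of "x + s *\<^sub>R a + t *\<^sub>R b"] n1[of s] s tm by (simp add: add.assoc \<delta>_def)
    also have "\<dots> \<le> \<epsilon> * (t * m)" using n1[of s] s assms by simp
    finally have r1: "norm ?r1 \<le> \<epsilon> * (t * m)" .
    have "norm ?r2 \<le> \<epsilon> * norm (s *\<^sub>R a)"
      using \<delta>1(2)[of "x + s *\<^sub>R a"] n2[of s] s tm by (simp add: \<delta>_def)
    also have "\<dots> \<le> \<epsilon> * (t * m)" using n2[of s] s assms by simp
    finally have r2: "norm ?r2 \<le> \<epsilon> * (t * m)" .
    have "(g (x + s *\<^sub>R a + t *\<^sub>R b) - g (x + s *\<^sub>R a)) \<bullet> a - t * (a \<bullet> (H x *v b)) = (?r1 - ?r2) \<bullet> a"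
      by (simp add: matrix_vector_right_distrib matrix_vector_mult_scaleR inner_diff_left
          inner_add_left inner_commute algebra_simps)
    also have "\<bar>\<dots>\<bar> \<le> norm (?r1 - ?r2) * norm a" by (rule Cauchy_Schwarz_ineq2)
    also have "\<dots> \<le> (2 * \<epsilon> * (t * m)) * m"
    proof (rule mult_mono)
      show "norm (?r1 - ?r2) \<le> 2 * \<epsilon> * (t * m)"
        using norm_triangle_ineq4[of ?r1 ?r2] r1 r2 by linarith
    qed (use t \<open>\<epsilon> > 0\<close> \<open>m \<ge> 0\<close> in \<open>auto simp: m_def\<close>)
    finally have "\<bar>t * ((g (x + s *\<^sub>R a + t *\<^sub>R b) - g (x + s *\<^sub>R a)) \<bullet> a - t * (a \<bullet> (H x *v b)))\<bar>
        \<le> t * ((2 * \<epsilon> * (t * m)) * m)"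
      using t by (simp add: abs_mult)
    then show ?thesis using s(3) by (simp add: algebra_simps power2_eq_square)
  qed
  moreover have "\<delta> / (m + 1) > 0"
    using \<delta>1 \<delta>2 \<open>m \<ge> 0\<close> by (simp add: \<delta>_def)
  ultimately show ?thesis unfolding m_def by blast
qed

text \<open>\<open>F\<close> is constrained only on \<open>sym_mats\<close>, whereas
  \<open>hessian\<close> is defined as a Jacobian; symmetry is what lets the structure conditions be
  applied to it.\<close>

lemma hessian_symmetric:
  assumes "open S" "x \<in> S" "twice_diff S w g H"
  shows "transpose (H x) = H x"
proof -
  have "a \<bullet> (H x *v b) = b \<bullet> (H x *v a)" for a b
  proof -
    define M where "M = (norm a + norm b)\<^sup>2"
    have "\<bar>a \<bullet> (H x *v b) - b \<bullet> (H x *v a)\<bar> \<le> 0 + e" if "e > 0" for e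
    proof -
      \<comment> \<open>Two estimates with error \<open>2 * \<epsilon> * M * t\<^sup>2\<close> are
        added; the summand 1 covers \<open>M = 0\<close>.\<close>
      define \<epsilon> where "\<epsilon> = e / (4 * (M + 1))"
      have "M \<ge> 0" by (simp add: M_def)
      then have \<epsilon>: "\<epsilon> > 0" using that by (simp add: \<epsilon>_def)
      obtain d1 d2 where d: "d1 > 0" "d2 > 0"
        and d1: "\<And>t. 0 < t \<Longrightarrow> t < d1 \<Longrightarrow> \<bar>(w (x + t *\<^sub>R a + t *\<^sub>R b) - w (x + t *\<^sub>R a) -
          w (x + t *\<^sub>R b) + w x) - t\<^sup>2 * (a \<bullet> (H x *v b))\<bar> \<le> 2 * \<epsilon> * M * t\<^sup>2"
        and d2: "\<And>t. 0 < t \<Longrightarrow> t < d2 \<Longrightarrow> \<bar>(w (x + t *\<^sub>R b + t *\<^sub>R a) - w (x + t *\<^sub>R b) -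
          w (x + t *\<^sub>R a) + w x) - t\<^sup>2 * (b \<bullet> (H x *v a))\<bar> \<le> 2 * \<epsilon> * M * t\<^sup>2"
        using second_difference_estimate[OF assms \<epsilon>, of a b]
          second_difference_estimate[OF assms \<epsilon>, of b a]
        unfolding M_def by (metis add.commute)
      define t where "t = min d1 d2 / 2"
      have t: "0 < t" "t < d1" "t < d2" using d by (auto simp: t_def)
      have comm: "x + t *\<^sub>R b + t *\<^sub>R a = x + t *\<^sub>R a + t *\<^sub>R b" by simp
      have "\<bar>t\<^sup>2 * (a \<bullet> (H x *v b)) - t\<^sup>2 * (b \<bullet> (H x *v a))\<bar> \<le> 4 * \<epsilon> * M * t\<^sup>2"
        using d1[OF t(1,2)] d2[OF t(1,3)] unfolding comm by linarith
      then have "t\<^sup>2 * \<bar>a \<bullet> (H x *v b) - b \<bullet> (H x *v a)\<bar> \<le> t\<^sup>2 * (4 * \<epsilon> * M)"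
        by (simp add: abs_mult mult_ac flip: right_diff_distrib)
      then have "\<bar>a \<bullet> (H x *v b) - b \<bullet> (H x *v a)\<bar> \<le> 4 * \<epsilon> * M"
        using t by simp
      also have "\<dots> \<le> e"
        using \<open>M \<ge> 0\<close> that by (simp add: \<epsilon>_def field_simps)
      finally show ?thesis by simp
    qed
    then have "\<bar>a \<bullet> (H x *v b) - b \<bullet> (H x *v a)\<bar> \<le> 0"
      by (rule field_le_epsilon)
    then show ?thesis by simp
  qed
  from this[of "axis _ 1" "axis _ 1"] show ?thesis
    by (simp add: axis_matrix_axis transpose_def vec_eq_iff)
qed

lemma twice_diff_grad_hessian:
  assumes "\<And>x. x \<in> S \<Longrightarrow> u differentiable (at x)" "\<And>x. x \<in> S \<Longrightarrow> grad u differentiable (at x)"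
  shows "twice_diff S u (grad u) (hessian u)"
  unfolding twice_diff_def
proof (intro ballI conjI)
  fix x assume x: "x \<in> S"
  show "(u has_derivative (\<lambda>h. grad u x \<bullet> h)) (at x)"
    using grad_GDERIV[OF assms(1)[OF x]] by (simp add: gderiv_def inner_commute)
  show "(grad u has_derivative (*v) (hessian u x)) (at x)"
    using assms(2)[OF x] jacobian_works unfolding hessian_def by blast
qed

lemma twice_diff_gaussian:
  fixes y :: "real^'N"
  shows "twice_diff S (\<lambda>x. exp (- k * ((x - y) \<bullet> (x - y))))
    (\<lambda>x. (- 2 * k * exp (- k * ((x - y) \<bullet> (x - y)))) *\<^sub>R (x - y))
    (\<lambda>x. (2 * k * exp (- k * ((x - y) \<bullet> (x - y)))) *\<^sub>R ((2 * k) *\<^sub>R outer (x - y) - mat 1))"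
  unfolding twice_diff_def
proof (intro ballI conjI)
  fix x
  let ?E = "\<lambda>x. exp (- k * ((x - y) \<bullet> (x - y)))"
  have E: "(?E has_derivative (\<lambda>h. (- 2 * k * ?E x) * ((x - y) \<bullet> h))) (at x)"
    by (auto intro!: derivative_eq_intros simp: inner_commute algebra_simps)
  then show "(?E has_derivative (\<lambda>h. ((- 2 * k * ?E x) *\<^sub>R (x - y)) \<bullet> h)) (at x)"
    by simp
  have "((\<lambda>x. (- 2 * k * ?E x) *\<^sub>R (x - y)) has_derivative
      (\<lambda>h. (- 2 * k * ?E x) *\<^sub>R h + (- 2 * k * ((- 2 * k * ?E x) * ((x - y) \<bullet> h))) *\<^sub>R (x - y))) (at x)"
    by (rule derivative_eq_intros E refl | simp)+
  moreover have "(- 2 * k * e) *\<^sub>R h + (- 2 * k * ((- 2 * k * e) * ((x - y) \<bullet> h))) *\<^sub>R (x - y) =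
      ((2 * k * e) *\<^sub>R ((2 * k) *\<^sub>R outer (x - y) - mat 1)) *v h" for e h
    by (simp add: scaleR_matrix_vector_assoc[symmetric] matrix_vector_mult_diff_rdistrib outer_mult_vec
        scaleR_diff_right mult_ac)
  ultimately show "((\<lambda>x. (- 2 * k * ?E x) *\<^sub>R (x - y)) has_derivative
      (*v) ((2 * k * ?E x) *\<^sub>R ((2 * k) *\<^sub>R outer (x - y) - mat 1))) (at x)"
    by simp
qed

section \<open>The Hopf lemma and the strong maximum principle\<close>

lemma real_derivative_ge:
  fixes \<phi> :: "real \<Rightarrow> real"
  assumes "(\<phi> has_real_derivative d) (at 0)" "0 < a" "\<And>t. 0 < t \<Longrightarrow> t \<le> a \<Longrightarrow> \<phi> 0 + c * t \<le> \<phi> t"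
  shows "c \<le> d"
proof (rule tendsto_lowerbound)
  show "((\<lambda>h. (\<phi> (0 + h) - \<phi> 0) / h) \<longlongrightarrow> d) (at_right 0)"
    using assms(1) unfolding DERIV_def by (rule filterlim_mono) (auto simp: at_within_le_at)
  have "c \<le> (\<phi> (0 + h) - \<phi> 0) / h" if "0 < h" "h < a" for h
    using assms(3)[of h] that by (simp add: field_simps)
  then show "\<forall>\<^sub>F h in at_right 0. c \<le> (\<phi> (0 + h) - \<phi> 0) / h"
    using assms(2) eventually_at_right_field by blast
qed simp

text \<open>The barrier is \<open>exp (- k |x - y|\<^sup>2) - exp (- k \<rho>\<^sup>2)\<close> on the annulus
  \<open>\<rho> / 2 \<le> |x - y| \<le> \<rho>\<close>, with \<open>k\<close> so large that it is a strict subsolution there.\<close>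

lemma hopf_lemma:
  fixes w :: "real^'N \<Rightarrow> real" and \<alpha> \<beta> C L \<rho> :: real
  assumes \<alpha>: "0 < \<alpha>" "\<alpha> \<le> \<beta>" and C: "0 \<le> C" and L: "0 \<le> L" and \<rho>: "0 < \<rho>"
    and td: "twice_diff (ball y \<rho>) w g H"
    and ineq: "\<And>x. x \<in> ball y \<rho> \<Longrightarrow> pucci_min \<alpha> \<beta> (H x) \<le> C * norm (g x) + L * w x"
    and cont: "continuous_on (cball y \<rho>) w" and pos: "\<And>x. x \<in> ball y \<rho> \<Longrightarrow> 0 < w x"
    and x0: "dist y x0 = \<rho>"
  shows "\<exists>c>0. \<forall>t. 0 < t \<and> t \<le> 1/2 \<longrightarrow> c * t \<le> w (x0 + t *\<^sub>R (y - x0))"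
proof -
  \<comment> \<open>On the annulus the leading term is at least
    \<open>k * (k * \<alpha> * \<rho>\<^sup>2)\<close> times \<open>E\<close>, and the competing
    terms are at most \<open>k * M\<close> times \<open>E\<close>: the trace of \<open>A\<close>,
    the gradient term and, because \<open>k\<close> is at least 1, the zero-order term. The choice
    of \<open>k\<close> makes \<open>k * \<alpha> * \<rho>\<^sup>2\<close> exceed
    \<open>M\<close>.\<close>
  define M where "M = 2 * CARD('N) * \<beta> + 2 * C * \<rho> + L"
  define k where "k = 1 + M / (\<alpha> * \<rho>\<^sup>2)"
  define E where "E = (\<lambda>x. exp (- k * ((x - y) \<bullet> (x - y))))"
  define E0 where "E0 = exp (- k * \<rho>\<^sup>2)"
  define gh where "gh = (\<lambda>x. (- 2 * k * E x) *\<^sub>R (x - y))"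
  define Hh where "Hh = (\<lambda>x. (2 * k * E x) *\<^sub>R ((2 * k) *\<^sub>R outer (x - y) - mat 1))"
  have tdE: "twice_diff S E gh Hh" for S
    unfolding E_def gh_def Hh_def by (rule twice_diff_gaussian)
  have "M \<ge> 0" using \<alpha> C L \<rho> by (simp add: M_def)
  then have k: "k \<ge> 1" using \<alpha> \<rho> by (simp add: k_def)
  have kM: "k * \<alpha> * \<rho>\<^sup>2 > M"
    using \<alpha> \<rho> by (simp add: k_def field_simps)
  have E_pos: "E x > 0" for x by (simp add: E_def)
  have E0_pos: "E0 > 0" by (simp add: E0_def)
  have E_le_1: "E x \<le> 1" for x using k by (simp add: E_def)
  have E_norm: "E x = exp (- k * (norm (x - y))\<^sup>2)" for x
    by (simp add: E_def power2_norm_eq_inner)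
  have sub: "C * norm (gh z) + L * E z < E z * (2 * k * (2 * k * (\<alpha> * (norm (z - y))\<^sup>2) - CARD('N) * \<beta>))"
    if z: "\<rho> / 2 \<le> norm (z - y)" "norm (z - y) \<le> \<rho>" for z
  proof -
    let ?s = "norm (z - y)"
    have "(\<rho> / 2)\<^sup>2 \<le> ?s\<^sup>2" using z \<rho> by (intro power_mono) auto
    then have "(4 * k\<^sup>2 * \<alpha>) * (\<rho> / 2)\<^sup>2 \<le> (4 * k\<^sup>2 * \<alpha>) * ?s\<^sup>2"
      using \<alpha> by (intro mult_left_mono) auto
    also have "(4 * k\<^sup>2 * \<alpha>) * (\<rho> / 2)\<^sup>2 = k * (k * \<alpha> * \<rho>\<^sup>2)"
      by (simp add: power2_eq_square)
    finally have "k * (k * \<alpha> * \<rho>\<^sup>2) \<le> (4 * k\<^sup>2 * \<alpha>) * ?s\<^sup>2" .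
    moreover have "k * (k * \<alpha> * \<rho>\<^sup>2) > k * M" using kM k by simp
    moreover have "k * M = 2 * k * (CARD('N) * \<beta>) + 2 * (k * (C * \<rho>)) + k * L"
      by (simp add: M_def algebra_simps)
    moreover have "k * (C * ?s) \<le> k * (C * \<rho>)" using z C k by (intro mult_left_mono) auto
    moreover have "C * (2 * k * ?s) = 2 * (k * (C * ?s))" by simp
    moreover have "L \<le> k * L" using k L by (simp add: mult_le_cancel_right1)
    ultimately have "C * (2 * k * ?s) + L < (4 * k\<^sup>2 * \<alpha>) * ?s\<^sup>2 - 2 * k * (CARD('N) * \<beta>)"
      by linarith
    then have "E z * (C * (2 * k * ?s) + L) < E z * ((4 * k\<^sup>2 * \<alpha>) * ?s\<^sup>2 - 2 * k * (CARD('N) * \<beta>))"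
      using E_pos[of z] by simp
    moreover have "norm (gh z) = 2 * k * E z * ?s"
      using k E_pos[of z] by (simp add: gh_def abs_mult)
    ultimately show ?thesis by (simp add: algebra_simps power2_eq_square)
  qed
  have trace_Hh: "E z * (2 * k * (2 * k * (\<alpha> * (norm (z - y))\<^sup>2) - CARD('N) * \<beta>)) \<le> trace (A ** Hh z)"
    if A: "A \<in> elliptic_mats \<alpha> \<beta>" for A z
  proof -
    have "trace (A ** Hh z) = E z * (2 * k * (2 * k * ((z - y) \<bullet> (A *v (z - y))) - trace A))"
      by (simp add: Hh_def matrix_mult_scaleR trace_scaleR trace_mult_diff trace_mult_outer)
    moreover have "2 * k * (\<alpha> * (norm (z - y))\<^sup>2) - CARD('N) * \<beta> \<le>
        2 * k * ((z - y) \<bullet> (A *v (z - y))) - trace A"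
    proof -
      have "\<alpha> * (norm (z - y))\<^sup>2 \<le> (z - y) \<bullet> (A *v (z - y))"
        using elliptic_matsD(2)[OF A] by (simp add: power2_norm_eq_inner)
      then have "2 * k * (\<alpha> * (norm (z - y))\<^sup>2) \<le> 2 * k * ((z - y) \<bullet> (A *v (z - y)))"
        using k by (intro mult_left_mono) auto
      then show ?thesis using trace_elliptic_le[OF A] by linarith
    qed
    ultimately show ?thesis using k E_pos[of z] by (simp add: mult_left_mono)
  qed
  have w_nonneg: "w x \<ge> 0" if "x \<in> cball y \<rho>" for x
    using continuous_ge_on_closure[of "ball y \<rho>" w x 0] cont pos that \<rho> by (simp add: less_imp_le)
  define x1 where "x1 = y + (1/2) *\<^sub>R (x0 - y)"
  have "x1 \<in> sphere y (\<rho> / 2)" using x0 by (simp add: x1_def dist_norm norm_minus_commute)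
  moreover have "continuous_on (sphere y (\<rho> / 2)) w"
    using cont by (rule continuous_on_subset) (use \<rho> in auto)
  ultimately obtain x2 where x2: "x2 \<in> sphere y (\<rho> / 2)" "\<And>x. x \<in> sphere y (\<rho> / 2) \<Longrightarrow> w x2 \<le> w x"
    using continuous_attains_inf[of "sphere y (\<rho> / 2)" w] by (metis compact_sphere empty_iff)
  \<comment> \<open>The minimum of \<open>w\<close> on the inner sphere: as \<open>E - E0\<close> is
    at most 1, the barrier scaled by \<epsilon> lies below \<open>w\<close> there. On the outer
    sphere it vanishes.\<close>
  define \<epsilon> where "\<epsilon> = w x2"
  have \<epsilon>: "\<epsilon> > 0" using x2 pos \<rho> by (simp add: \<epsilon>_def)
  define S where "S = {x. \<rho> / 2 \<le> dist y x} \<inter> cball y \<rho>"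
  have "compact S"
    unfolding S_def by (intro closed_Int_compact closed_Collect_le continuous_intros) auto
  moreover have "x0 \<in> S" using x0 \<rho> by (simp add: S_def)
  then have "S \<noteq> {}" by blast
  moreover have "continuous_on S (\<lambda>x. w x - \<epsilon> * E x)"
    using cont unfolding E_def
    by (intro continuous_intros) (auto simp: S_def elim: continuous_on_subset)
  ultimately obtain z where z: "z \<in> S" "\<And>x. x \<in> S \<Longrightarrow> w z - \<epsilon> * E z \<le> w x - \<epsilon> * E x"
    using continuous_attains_inf by (metis (no_types, lifting))
  have comparison: "0 \<le> w z - \<epsilon> * (E z - E0)"
  proof (rule ccontr)
    assume neg: "\<not> 0 \<le> w z - \<epsilon> * (E z - E0)"
    have "dist y z \<noteq> \<rho>"
    proof
      assume "dist y z = \<rho>"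
      then have "E z = E0" "w z \<ge> 0"
        using w_nonneg by (auto simp: E_norm E0_def dist_norm norm_minus_commute)
      then show False using neg by simp
    qed
    moreover have "dist y z \<noteq> \<rho> / 2"
    proof
      assume "dist y z = \<rho> / 2"
      then have "\<epsilon> \<le> w z" using x2 by (simp add: \<epsilon>_def)
      moreover have "E z - E0 \<le> 1" using E_le_1[of z] E0_pos by linarith
      ultimately show False using neg \<epsilon> mult_left_le[of "E z - E0" \<epsilon>] by linarith
    qed
    ultimately have zd: "\<rho> / 2 < dist y z" "dist y z < \<rho>" using z by (auto simp: S_def)
    define U where "U = {x. \<rho> / 2 < dist y x} \<inter> ball y \<rho>"
    have U: "open U" "z \<in> U" "U \<subseteq> S" "U \<subseteq> ball y \<rho>"
      using zd by (auto simp: U_def S_def intro!: open_Int open_Collect_less continuous_intros)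
    have td': "twice_diff U (\<lambda>x. w x - \<epsilon> * E x) (\<lambda>x. g x - \<epsilon> *\<^sub>R gh x) (\<lambda>x. H x - \<epsilon> *\<^sub>R Hh x)"
      using td tdE U(4) twice_diff_diff_scaled twice_diff_subset by blast
    have g0: "g z = \<epsilon> *\<^sub>R gh z" and psd: "\<And>v. 0 \<le> v \<bullet> ((H z - \<epsilon> *\<^sub>R Hh z) *v v)"
      using local_min_second_order[OF U(1,2) td'] z(2) U(3) by auto
    have "\<epsilon> * (E z * (2 * k * (2 * k * (\<alpha> * (norm (z - y))\<^sup>2) - CARD('N) * \<beta>))) \<le> pucci_min \<alpha> \<beta> (H z)"
    proof (rule pucci_min_ge)
      fix A :: "real^'N^'N" assume A: "A \<in> elliptic_mats \<alpha> \<beta>"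
      have "0 \<le> v \<bullet> (A *v v)" for v
        using elliptic_matsD(2)[OF A, of v] \<alpha> by (smt (verit) inner_ge_zero mult_nonneg_nonneg)
      then have "0 \<le> trace (A ** (H z - \<epsilon> *\<^sub>R Hh z))"
        using trace_mult_psd_nonneg elliptic_matsD(1)[OF A] psd by blast
      then have "\<epsilon> * trace (A ** Hh z) \<le> trace (A ** H z)"
        by (simp add: trace_mult_diff matrix_mult_scaleR trace_scaleR)
      moreover have "\<epsilon> * (E z * (2 * k * (2 * k * (\<alpha> * (norm (z - y))\<^sup>2) - CARD('N) * \<beta>)))
          \<le> \<epsilon> * trace (A ** Hh z)"
        using trace_Hh[OF A] \<epsilon> by (intro mult_left_mono) auto
      ultimately show "\<epsilon> * (E z * (2 * k * (2 * k * (\<alpha> * (norm (z - y))\<^sup>2) - CARD('N) * \<beta>)))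
          \<le> trace (A ** H z)" by linarith
    qed (fact \<alpha>)
    moreover have "pucci_min \<alpha> \<beta> (H z) \<le> C * norm (g z) + L * w z"
      using ineq zd by simp
    \<comment> \<open>At a negative minimum \<open>w\<close> lies below the barrier, so its
      zero-order term is bounded by that of the barrier, which \<open>k\<close> already
      absorbs.\<close>
    moreover have "L * w z \<le> L * (\<epsilon> * E z)"
    proof -
      have "w z \<le> \<epsilon> * E z" using neg \<epsilon> by (simp add: E0_def algebra_simps) (smt (verit) exp_gt_zero mult_pos_pos)
      then show ?thesis using L by (rule mult_left_mono)
    qed
    moreover have "C * norm (g z) = \<epsilon> * (C * norm (gh z))" using g0 \<epsilon> by simp
    moreover have "\<epsilon> * (C * norm (gh z) + L * E z) <
        \<epsilon> * (E z * (2 * k * (2 * k * (\<alpha> * (norm (z - y))\<^sup>2) - CARD('N) * \<beta>)))"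
      using sub[of z] zd \<epsilon> by (simp add: dist_norm norm_minus_commute)
    ultimately show False by (simp add: algebra_simps)
  qed
  \<comment> \<open>Along the inner normal the barrier is
    \<open>E0 * (exp (k * \<rho>\<^sup>2 * (2 * t - t\<^sup>2)) - 1)\<close>, and
    \<open>2 * t - t\<^sup>2\<close> is at least \<open>t\<close>. The bound 1/2 on \<open>t\<close>
    keeps the point in the annulus.\<close>
  define c where "c = \<epsilon> * (E0 * (k * \<rho>\<^sup>2))"
  have "c > 0" using \<epsilon> k \<rho> by (simp add: c_def E0_def)
  moreover have "c * t \<le> w (x0 + t *\<^sub>R (y - x0))" if t: "0 < t" "t \<le> 1/2" for t
  proof -
    let ?x = "x0 + t *\<^sub>R (y - x0)"
    have xy: "?x - y = (1 - t) *\<^sub>R (x0 - y)" by (simp add: algebra_simps)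
    then have nx: "norm (?x - y) = (1 - t) * \<rho>"
      using x0 t by (simp add: dist_norm norm_minus_commute)
    then have "dist y ?x = (1 - t) * \<rho>" by (simp add: dist_norm norm_minus_commute)
    then have "?x \<in> S" using t \<rho> by (simp add: S_def)
    then have "\<epsilon> * (E ?x - E0) \<le> w ?x"
      using z(2)[of ?x] comparison by (simp add: algebra_simps)
    moreover have "E0 * (k * \<rho>\<^sup>2 * t) \<le> E ?x - E0"
    proof -
      have "E ?x = E0 * exp (k * \<rho>\<^sup>2 * (2 * t - t\<^sup>2))"
        unfolding E_norm nx E0_def exp_add[symmetric] by (simp add: power2_eq_square algebra_simps)
      moreover have "1 + k * \<rho>\<^sup>2 * (2 * t - t\<^sup>2) \<le> exp (k * \<rho>\<^sup>2 * (2 * t - t\<^sup>2))"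
        by (rule exp_ge_add_one_self)
      moreover have "k * \<rho>\<^sup>2 * t \<le> k * \<rho>\<^sup>2 * (2 * t - t\<^sup>2)"
      proof (rule mult_left_mono)
        show "t \<le> 2 * t - t\<^sup>2"
          using t mult_left_le[of t t] by (simp add: power2_eq_square)
      qed (use k in simp)
      ultimately have "k * \<rho>\<^sup>2 * t \<le> exp (k * \<rho>\<^sup>2 * (2 * t - t\<^sup>2)) - 1"
        "E ?x - E0 = E0 * (exp (k * \<rho>\<^sup>2 * (2 * t - t\<^sup>2)) - 1)" by (auto simp: algebra_simps)
      moreover have "E0 > 0" by (simp add: E0_def)
      ultimately show ?thesis by (simp del: times_divide_eq_right add: mult_left_mono)
    qed
    then have "\<epsilon> * (E0 * (k * \<rho>\<^sup>2 * t)) \<le> \<epsilon> * (E ?x - E0)"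
      using \<epsilon> by (intro mult_left_mono) auto
    ultimately show ?thesis by (simp add: c_def mult_ac)
  qed
  ultimately show ?thesis by blast
qed

text \<open>The zero set is closed in \<open>D\<close>, and the Hopf lemma makes it open: a nonzero
  point \<open>a\<close> close to a zero is the centre of a largest ball free of zeros, and this
  ball touches the zero set at a point where \<open>w\<close> is minimal, hence has zero gradient,
  against the linear growth along the inner normal.\<close>

lemma strong_maximum_principle:
  fixes w :: "real^'N \<Rightarrow> real" and \<alpha> \<beta> C L :: real
  assumes \<alpha>: "0 < \<alpha>" "\<alpha> \<le> \<beta>" and C: "0 \<le> C" and L: "0 \<le> L"
    and D: "open D" "connected D" and td: "twice_diff D w g H"
    and ineq: "\<And>x. x \<in> D \<Longrightarrow> pucci_min \<alpha> \<beta> (H x) \<le> C * norm (g x) + L * w x"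
    and nonneg: "\<And>x. x \<in> D \<Longrightarrow> 0 \<le> w x"
    and z: "z \<in> D" "w z = 0" and "x \<in> D"
  shows "w x = 0"
proof -
  define Z where "Z = {x \<in> D. w x = 0}"
  have contD: "continuous_on D w" using td by (rule twice_diff_continuous_on)
  have "closedin (top_of_set D) Z"
    unfolding Z_def by (rule continuous_closedin_preimage_constant[OF contD])
  moreover have "open Z"
    unfolding open_contains_ball
  proof
    fix z assume "z \<in> Z"
    then have z: "z \<in> D" "w z = 0" by (auto simp: Z_def)
    then obtain e where e: "e > 0" "ball z e \<subseteq> D" using D openE by blast
    \<comment> \<open>The zero \<open>z\<close> is closer to \<open>a\<close> than \<open>r\<close>,
      so the touching ball has radius below \<open>r\<close> and lies in
      \<open>cball z (2 * r)\<close>, where \<open>K\<close> is closed; the factor 4 leaves room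
      inside \<open>D\<close>.\<close>
    define r where "r = e / 4"
    have r: "r > 0" using e by (simp add: r_def)
    have near: "x \<in> D" if "dist z x \<le> 3 * r" for x
      using e that by (auto simp: r_def)
    have "a \<in> Z" if a: "a \<in> ball z r" for a
    proof (rule ccontr)
      assume "a \<notin> Z"
      have aD: "a \<in> D" using near[of a] a r by simp
      then have wa: "w a \<noteq> 0" using \<open>a \<notin> Z\<close> by (simp add: Z_def)
      define K where "K = {x \<in> cball z (2 * r). w x = 0}"
      have "continuous_on (cball z (2 * r)) w"
        using contD by (rule continuous_on_subset) (use near r in auto)
      then have "closed K"
        unfolding K_def by (intro continuous_closed_preimage_constant) auto
      moreover have "z \<in> K" using z r by (simp add: K_def)
      ultimately obtain x0 where x0: "x0 \<in> K" "\<And>y. y \<in> K \<Longrightarrow> dist a x0 \<le> dist a y"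
        using distance_attains_inf[of K a] by (metis empty_iff)
      define \<rho> where "\<rho> = dist a x0"
      have wx0: "w x0 = 0" using x0 by (simp add: K_def)
      then have \<rho>: "\<rho> > 0" using wa by (auto simp: \<rho>_def)
      have "\<rho> < r" using x0(2)[OF \<open>z \<in> K\<close>] a by (simp add: \<rho>_def dist_commute)
      then have sub2: "x \<in> cball z (2 * r)" if "dist a x \<le> \<rho>" for x
        using that a dist_triangle[of z x a] by simp
      have subD: "cball a \<rho> \<subseteq> D" using sub2 near r by fastforce
      have "0 < w x" if x: "x \<in> ball a \<rho>" for x
      proof -
        have "x \<notin> K" using x0(2)[of x] x by (auto simp: \<rho>_def)
        then have "w x \<noteq> 0" using x sub2[of x] by (auto simp: K_def)
        moreover have "0 \<le> w x" using nonneg[of x] subsetD[OF subD, of x] x by simp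
        ultimately show ?thesis by simp
      qed
      moreover have "ball a \<rho> \<subseteq> D" using subD by auto
      ultimately have "\<exists>c>0. \<forall>t. 0 < t \<and> t \<le> 1/2 \<longrightarrow> c * t \<le> w (x0 + t *\<^sub>R (a - x0))"
        using td ineq subD contD \<rho>
        by (intro hopf_lemma[OF \<alpha> C L \<rho>, where g = g and H = H])
          (auto simp: \<rho>_def intro: twice_diff_subset continuous_on_subset)
      then obtain c where c: "c > 0" "\<And>t. 0 < t \<Longrightarrow> t \<le> 1/2 \<Longrightarrow> c * t \<le> w (x0 + t *\<^sub>R (a - x0))"
        by blast
      have x0D: "x0 \<in> D" using subD \<rho> by (auto simp: \<rho>_def)
      have g0: "g x0 = 0"
        using local_min_second_order(1)[OF D(1) x0D td] nonneg wx0 by simp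
      have "((\<lambda>s. w (x0 + s *\<^sub>R (a - x0))) has_real_derivative 0) (at 0)"
        using twice_diff_line(1)[OF td, of x0 0 "a - x0"] x0D g0 by simp
      then have "c \<le> 0"
        by (rule real_derivative_ge[where a = "1/2"]) (use c wx0 in auto)
      then show False using c by simp
    qed
    then show "\<exists>e>0. ball z e \<subseteq> Z" using r by blast
  qed
  then have "openin (top_of_set D) Z"
    by (simp add: Z_def openin_open_eq[OF D(1)])
  moreover have "Z \<noteq> {}" using z by (auto simp: Z_def)
  ultimately have "Z = D" using D(2) unfolding connected_clopen by blast
  then show ?thesis using \<open>x \<in> D\<close> by (auto simp: Z_def)
qed

section \<open>Boundary behaviour of positive functions on a ball\<close>

text \<open>Strict convexity of the Euclidean ball. It allows mean value arguments on chords with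
  both ends on the sphere, although derivatives exist only inside.\<close>

lemma open_chord_in_ball:
  fixes x y :: "'a::real_inner"
  assumes "x \<in> cball 0 R" "y \<in> cball 0 R" "x \<noteq> y" "0 < s" "s < 1"
  shows "x + s *\<^sub>R (y - x) \<in> ball 0 R"
proof -
  have R: "0 \<le> R" using assms(1) by (metis dist_0_norm mem_cball norm_ge_zero order_trans)
  have "(norm (x + s *\<^sub>R (y - x)))\<^sup>2 =
      (1 - s) * (norm x)\<^sup>2 + s * (norm y)\<^sup>2 - s * (1 - s) * (norm (y - x))\<^sup>2"
    by (simp add: power2_norm_eq_inner inner_add_left inner_add_right inner_diff_left
        inner_diff_right inner_commute algebra_simps)
  also have "\<dots> < (1 - s) * (norm x)\<^sup>2 + s * (norm y)\<^sup>2"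
    using assms by simp
  also have "\<dots> \<le> (1 - s) * R\<^sup>2 + s * R\<^sup>2"
    using assms by (intro add_mono mult_left_mono power_mono) auto
  also have "\<dots> = R\<^sup>2" by (simp add: algebra_simps)
  finally show ?thesis using R by (simp add: power_less_imp_less_base)
qed

lemma small_step:
  fixes v :: "'a::real_normed_vector" and d \<delta> :: real
  assumes "0 < d" "0 < \<delta>"
  shows "\<exists>t>0. t < d \<and> t * norm v < \<delta>"
proof -
  have "eventually (\<lambda>t. t < d \<and> t * norm v < \<delta> \<and> t > 0) (at_right 0)"
  proof (intro eventually_conj)
    have "((\<lambda>t. t * norm v) \<longlongrightarrow> 0 * norm v) (at_right 0)" by (intro tendsto_intros)
    then show "eventually (\<lambda>t. t * norm v < \<delta>) (at_right 0)"
      using assms by (intro order_tendstoD) auto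
    show "eventually (\<lambda>t. t < d) (at_right 0)"
      using assms(1) eventually_at_right_field by blast
  qed (rule eventually_at_right_less)
  then show ?thesis
    using eventually_happens'[OF trivial_limit_at_right_real] by blast
qed

lemma inward_ray_in_ball:
  fixes b v :: "'a::euclidean_space"
  assumes "norm b = R" "v \<bullet> b < 0"
  shows "\<exists>d>0. \<forall>t. 0 < t \<and> t < d \<longrightarrow> b + t *\<^sub>R v \<in> ball 0 R"
proof -
  have v: "v \<bullet> v > 0" using assms by auto
  \<comment> \<open>The parameter at which the ray through \<open>b\<close> meets the sphere
    again.\<close>
  define d where "d = - 2 * (v \<bullet> b) / (v \<bullet> v)"
  have "b + t *\<^sub>R v \<in> ball 0 R" if t: "0 < t" "t < d" for t
  proof -
    have "t * (v \<bullet> v) < - 2 * (v \<bullet> b)" using t(2) unfolding d_def pos_less_divide_eq[OF v] by simp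
    then have "t * (t * (v \<bullet> v)) < t * (- 2 * (v \<bullet> b))" using t by (intro mult_strict_left_mono)
    then have "(norm (b + t *\<^sub>R v))\<^sup>2 < (norm b)\<^sup>2"
      by (simp add: power2_norm_eq_inner inner_add_left inner_add_right inner_commute)
    then have "norm (b + t *\<^sub>R v) < norm b" by (rule power_less_imp_less_base) simp
    then show ?thesis using assms by simp
  qed
  moreover have "d > 0" using v assms by (simp add: d_def divide_neg_pos)
  ultimately show ?thesis by blast
qed

text \<open>On the sphere \<open>G\<close> and \<open>H\<close> are limits from inside, not
  derivatives, because \<open>w\<close> is arbitrary outside the closed ball. All boundary
  statements are therefore obtained from chords.\<close>

locale ball_C2 =
  fixes R :: real and w :: "real^'N \<Rightarrow> real"
    and G :: "real^'N \<Rightarrow> real^'N" and H :: "real^'N \<Rightarrow> real^'N^'N"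
  assumes R_pos: "R > 0" and td: "twice_diff (ball 0 R) w G H"
    and cont_w: "continuous_on (cball 0 R) w" and cont_G: "continuous_on (cball 0 R) G"
    and cont_H: "continuous_on (cball 0 R) H"
    and w_pos: "\<And>x. x \<in> ball 0 R \<Longrightarrow> 0 < w x" and w_zero: "\<And>x. norm x = R \<Longrightarrow> w x = 0"
begin

lemma chord_MVT:
  assumes "x \<in> cball 0 R" "y \<in> cball 0 R" "x \<noteq> y"
  shows "\<exists>s. 0 < s \<and> s < 1 \<and> w y - w x = G (x + s *\<^sub>R (y - x)) \<bullet> (y - x)"
    and "\<exists>s. 0 < s \<and> s < 1 \<and> (G y - G x) \<bullet> v = v \<bullet> (H (x + s *\<^sub>R (y - x)) *v (y - x))"
proof -
  note inb = open_chord_in_ball[OF assms]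
  have inc: "x + s *\<^sub>R (y - x) \<in> cball 0 R" if "0 \<le> s" "s \<le> 1" for s
    using convexD_alt[OF convex_cball assms(1,2) that] by (simp add: algebra_simps)
  have lin: "continuous_on {0..1} (\<lambda>s. x + s *\<^sub>R (y - x))" by (intro continuous_intros)
  have c1: "continuous_on {0..1} (\<lambda>s. w (x + s *\<^sub>R (y - x)))"
    by (rule continuous_on_compose2[OF cont_w lin]) (use inc in auto)
  have c2: "continuous_on {0..1} (\<lambda>s. G (x + s *\<^sub>R (y - x)))"
    by (rule continuous_on_compose2[OF cont_G lin]) (use inc in auto)
  note d1 = twice_diff_line(1)[OF td inb, unfolded has_field_derivative_def]
  have "\<exists>s>0. s < 1 \<and> w (x + 1 *\<^sub>R (y - x)) - w (x + 0 *\<^sub>R (y - x)) =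
      (G (x + s *\<^sub>R (y - x)) \<bullet> (y - x)) * (1 - 0)"
    by (rule mvt[OF _ c1 d1]) auto
  then show "\<exists>s. 0 < s \<and> s < 1 \<and> w y - w x = G (x + s *\<^sub>R (y - x)) \<bullet> (y - x)"
    by auto
  note d2 = twice_diff_line(2)[OF td inb, where v' = v, unfolded has_field_derivative_def]
  have "\<exists>s>0. s < 1 \<and> G (x + 1 *\<^sub>R (y - x)) \<bullet> v - G (x + 0 *\<^sub>R (y - x)) \<bullet> v =
      (v \<bullet> (H (x + s *\<^sub>R (y - x)) *v (y - x))) * (1 - 0)"
    by (rule mvt[OF _ _ d2]) (auto intro!: continuous_intros c2)
  then show "\<exists>s. 0 < s \<and> s < 1 \<and> (G y - G x) \<bullet> v = v \<bullet> (H (x + s *\<^sub>R (y - x)) *v (y - x))"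
    by (auto simp: inner_diff_left)
qed

text \<open>Two applications of the mean value theorem. The factor \<open>r\<close> is the first
  intermediate parameter instead of 1/2, which is harmless because only the sign or the vanishing of
  the quadratic form is used.\<close>

lemma chord_taylor:
  assumes "x \<in> cball 0 R" "y \<in> cball 0 R" "x \<noteq> y" "w x = 0" "G x = 0"
  shows "\<exists>r s. 0 < r \<and> 0 < s \<and> s < 1 \<and> w y = r * ((y - x) \<bullet> (H (x + s *\<^sub>R (y - x)) *v (y - x)))"
proof -
  obtain s1 where s1: "0 < s1" "s1 < 1" "w y = G (x + s1 *\<^sub>R (y - x)) \<bullet> (y - x)"
    using chord_MVT(1)[OF assms(1-3)] assms(4) by auto
  let ?z = "x + s1 *\<^sub>R (y - x)"
  have "?z \<in> ball 0 R" using open_chord_in_ball[OF assms(1-3) s1(1,2)] .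
  moreover have "x \<noteq> ?z" using s1 assms by auto
  ultimately obtain s2 where s2: "0 < s2" "s2 < 1"
    "(G ?z - G x) \<bullet> (y - x) = (y - x) \<bullet> (H (x + s2 *\<^sub>R (?z - x)) *v (?z - x))"
    using chord_MVT(2)[of x ?z "y - x"] assms(1) by auto
  have "w y = s1 * ((y - x) \<bullet> (H (x + (s2 * s1) *\<^sub>R (y - x)) *v (y - x)))"
    using s1(3) s2(3) assms(5) by (simp add: matrix_vector_mult_scaleR)
  moreover have "s2 * s1 < 1" using s1 s2 by (metis mult_strict_mono less_imp_le mult_1 zero_less_one)
  ultimately show ?thesis using s1 s2 by (metis mult_pos_pos)
qed

text \<open>The direction is allowed to vary as well, since chords of the sphere have directions
  that only converge to a tangent vector.\<close>

lemma hessian_form_sign_near: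
  assumes b: "b \<in> cball 0 R" and nz: "v \<bullet> (H b *v v) \<noteq> 0"
  shows "\<exists>\<delta>>0. \<forall>x\<in>cball 0 R. \<forall>v'. dist x b < \<delta> \<longrightarrow> dist v' v < \<delta> \<longrightarrow>
    0 < (v \<bullet> (H b *v v)) * (v' \<bullet> (H x *v v'))"
proof -
  let ?q = "v \<bullet> (H b *v v)"
  have HH: "continuous_on (cball 0 R \<times> UNIV) (\<lambda>z. H (fst z))"
    by (rule continuous_on_compose2[OF cont_H]) (auto intro: continuous_intros)
  have "continuous_on (cball 0 R \<times> UNIV) (\<lambda>z. ?q * (snd z \<bullet> (H (fst z) *v snd z)))"
    unfolding matrix_vector_mult_def using HH by (intro continuous_intros)
  then have "((\<lambda>z. ?q * (snd z \<bullet> (H (fst z) *v snd z))) \<longlongrightarrow> ?q * ?q)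
      (at (b, v) within cball 0 R \<times> UNIV)"
    using b unfolding continuous_on_def by force
  moreover have "?q * ?q > 0" using nz by (simp add: not_square_less_zero zero_less_mult_iff) linarith
  ultimately have "\<forall>\<^sub>F z in at (b, v) within cball 0 R \<times> UNIV. 0 < ?q * (snd z \<bullet> (H (fst z) *v snd z))"
    by (rule order_tendstoD)
  then obtain d where d: "d > 0" "\<And>z. z \<in> cball 0 R \<times> UNIV \<Longrightarrow> z \<noteq> (b, v) \<Longrightarrow> dist z (b, v) < d \<Longrightarrow>
      0 < ?q * (snd z \<bullet> (H (fst z) *v snd z))"
    unfolding eventually_at by auto
  have "0 < ?q * (v' \<bullet> (H x *v v'))" if x: "x \<in> cball 0 R" "dist x b < d / 2" "dist v' v < d / 2" for x v'
  proof (cases "(x, v') = (b, v)")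
    case True
    then show ?thesis using \<open>?q * ?q > 0\<close> by simp
  next
    case False
    have "dist (x, v') (b, v) \<le> dist x b + dist v' v"
      by (simp add: dist_Pair_Pair sqrt_sum_squares_le_sum)
    then have "dist (x, v') (b, v) < d" using x by linarith
    then show ?thesis using d(2)[of "(x, v')"] x False by simp
  qed
  then show ?thesis using d(1) by (intro exI[of _ "d / 2"]) auto
qed

lemma inward_derivative_nonneg:
  assumes b: "norm b = R" and v: "v \<bullet> b < 0"
  shows "0 \<le> G b \<bullet> v"
proof (rule ccontr)
  assume neg: "\<not> 0 \<le> G b \<bullet> v"
  have bc: "b \<in> cball 0 R" using b by simp
  have "((\<lambda>x. G x \<bullet> v) \<longlongrightarrow> G b \<bullet> v) (at b within cball 0 R)"
    using cont_G bc by (auto simp: continuous_on_def intro: tendsto_intros)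
  then have "\<forall>\<^sub>F x in at b within cball 0 R. G x \<bullet> v < 0"
    using neg by (intro order_tendstoD) auto
  then obtain \<delta> where \<delta>: "\<delta> > 0" "\<And>x. x \<in> cball 0 R \<Longrightarrow> x \<noteq> b \<Longrightarrow> dist x b < \<delta> \<Longrightarrow> G x \<bullet> v < 0"
    unfolding eventually_at by auto
  obtain d where d: "d > 0" "\<And>t. 0 < t \<Longrightarrow> t < d \<Longrightarrow> b + t *\<^sub>R v \<in> ball 0 R"
    using inward_ray_in_ball[OF b v] by blast
  obtain t where t: "0 < t" "t < d" "t * norm v < \<delta>"
    using small_step[OF d(1) \<delta>(1)] by blast
  have v0: "v \<noteq> 0" using v by auto
  have y: "b + t *\<^sub>R v \<in> ball 0 R" using d t by simp
  obtain s where s: "0 < s" "s < 1" "w (b + t *\<^sub>R v) - w b = G (b + s *\<^sub>R (t *\<^sub>R v)) \<bullet> (t *\<^sub>R v)"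
    using chord_MVT(1)[OF bc, of "b + t *\<^sub>R v"] y t v0 by auto
  have "b + s *\<^sub>R (t *\<^sub>R v) \<in> ball 0 R"
    using open_chord_in_ball[OF bc _ _ s(1,2), of "b + t *\<^sub>R v"] y t v0 by auto
  moreover have "s * (t * norm v) \<le> t * norm v"
    using s t by (intro mult_left_le_one_le) auto
  then have "s * t * norm v < \<delta>" using t by (simp only: mult.assoc)
  ultimately have "G (b + s *\<^sub>R (t *\<^sub>R v)) \<bullet> v < 0"
    using \<delta>(2)[of "b + s *\<^sub>R (t *\<^sub>R v)"] s t v0 by (simp add: dist_norm)
  then have "w (b + t *\<^sub>R v) - w b < 0" using s(3) t by (simp add: mult_pos_neg)
  then show False using w_pos[OF y] w_zero[OF b] by simp
qed

text \<open>A small tilt of \<open>- e\<close> against the gradient is still an inward direction; if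
  the derivative along \<open>e\<close> is zero, the derivative along the tilted direction is a
  negative multiple of the squared norm of the gradient.\<close>

lemma grad_eq_0_of_tangential:
  assumes b: "norm b = R" and e: "e \<bullet> b > 0" "G b \<bullet> e = 0"
  shows "G b = 0"
proof -
  \<comment> \<open>Small enough to keep the tilted vector inward; the summand 1 avoids a zero
    denominator.\<close>
  define s where "s = (e \<bullet> b) / (2 * (\<bar>G b \<bullet> b\<bar> + 1))"
  have s: "s > 0" using e by (simp add: s_def add_nonneg_pos)
  have "s * \<bar>G b \<bullet> b\<bar> < e \<bullet> b"
  proof -
    have "s * (\<bar>G b \<bullet> b\<bar> + 1) = (e \<bullet> b) / 2" by (simp add: s_def field_simps add_nonneg_eq_0_iff)
    then show ?thesis using s e by (simp add: algebra_simps)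
  qed
  then have "(- e - s *\<^sub>R G b) \<bullet> b < 0"
    using s abs_le_iff[of "G b \<bullet> b" "\<bar>G b \<bullet> b\<bar>"] mult_left_mono[of "- (G b \<bullet> b)" "\<bar>G b \<bullet> b\<bar>" s]
    by (simp add: inner_diff_left)
  then have "0 \<le> G b \<bullet> (- e - s *\<^sub>R G b)" by (rule inward_derivative_nonneg[OF b])
  then have "s * (G b \<bullet> G b) \<le> 0" using e by (simp add: inner_diff_right)
  then show ?thesis using s by (simp add: mult_le_0_iff) (metis inner_ge_zero inner_eq_zero_iff order_antisym)
qed

lemma inward_second_derivative_nonneg:
  assumes b: "norm b = R" and v: "v \<bullet> b < 0" and G0: "G b = 0"
  shows "0 \<le> v \<bullet> (H b *v v)"
proof (rule ccontr)
  assume neg: "\<not> 0 \<le> v \<bullet> (H b *v v)"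
  have bc: "b \<in> cball 0 R" using b by simp
  obtain \<delta> where \<delta>: "\<delta> > 0" "\<And>x v'. x \<in> cball 0 R \<Longrightarrow> dist x b < \<delta> \<Longrightarrow> dist v' v < \<delta> \<Longrightarrow>
    0 < (v \<bullet> (H b *v v)) * (v' \<bullet> (H x *v v'))"
    using hessian_form_sign_near[OF bc, of v] neg by auto
  obtain d where d: "d > 0" "\<And>t. 0 < t \<Longrightarrow> t < d \<Longrightarrow> b + t *\<^sub>R v \<in> ball 0 R"
    using inward_ray_in_ball[OF b v] by blast
  obtain t where t: "0 < t" "t < d" "t * norm v < \<delta>"
    using small_step[OF d(1) \<delta>(1)] by blast
  have v0: "v \<noteq> 0" using v by auto
  have y: "b + t *\<^sub>R v \<in> ball 0 R" using d t by simp
  obtain r s where s: "0 < r" "0 < s" "s < 1"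
    "w (b + t *\<^sub>R v) = r * ((t *\<^sub>R v) \<bullet> (H (b + s *\<^sub>R (t *\<^sub>R v)) *v (t *\<^sub>R v)))"
    using chord_taylor[OF bc, of "b + t *\<^sub>R v"] y t v0 G0 w_zero[OF b] by auto
  have "b + s *\<^sub>R (t *\<^sub>R v) \<in> ball 0 R"
    using open_chord_in_ball[OF bc _ _ s(2,3), of "b + t *\<^sub>R v"] y t v0 by auto
  moreover have "s * (t * norm v) \<le> t * norm v"
    using s t by (intro mult_left_le_one_le) auto
  then have "s * t * norm v < \<delta>" using t by (simp only: mult.assoc)
  ultimately have "0 < (v \<bullet> (H b *v v)) * (v \<bullet> (H (b + s *\<^sub>R (t *\<^sub>R v)) *v v))"
    using \<delta>(2)[of "b + s *\<^sub>R (t *\<^sub>R v)" v] \<delta>(1) s t by (simp add: dist_norm)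
  then have "v \<bullet> (H (b + s *\<^sub>R (t *\<^sub>R v)) *v v) < 0"
    using neg by (simp add: zero_less_mult_iff)
  then have "w (b + t *\<^sub>R v) < 0"
    using s t by (simp add: matrix_vector_mult_scaleR mult_pos_neg)
  then show False using w_pos[OF y] by simp
qed

text \<open>Compare with the Taylor expansion at \<open>b\<close> along short chords of the sphere, on which \<open>w\<close>
  vanishes at both ends.\<close>

lemma tangential_second_derivative:
  assumes b: "norm b = R" and v: "v \<bullet> b = 0" and G0: "G b = 0"
  shows "v \<bullet> (H b *v v) = 0"
proof -
  have bc: "b \<in> cball 0 R" using b by simp
  have *: "v \<bullet> (H b *v v) = 0" if v: "v \<bullet> b = 0" "norm v = R" for v
  proof (rule ccontr)
    assume "v \<bullet> (H b *v v) \<noteq> 0"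
    then obtain \<delta> where \<delta>: "\<delta> > 0" "\<And>x v'. x \<in> cball 0 R \<Longrightarrow> dist x b < \<delta> \<Longrightarrow> dist v' v < \<delta> \<Longrightarrow>
      0 < (v \<bullet> (H b *v v)) * (v' \<bullet> (H x *v v'))"
      using hessian_form_sign_near[OF bc, of v] by auto
    \<comment> \<open>The great circle through \<open>b\<close> with velocity \<open>v\<close>; this
      is where \<open>norm v = R\<close> is used.\<close>
    define c where "c = (\<lambda>t. cos t *\<^sub>R b + sin t *\<^sub>R v)"
    have nc: "norm (c t) = R" for t
    proof -
      have "(norm (c t))\<^sup>2 = (cos t)\<^sup>2 * (norm b)\<^sup>2 + (sin t)\<^sup>2 * (norm v)\<^sup>2"
        using v(1)
        by (simp only: c_def power2_norm_eq_inner)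
          (simp add: inner_add_left inner_add_right inner_commute[of b v] power2_eq_square)
      also have "\<dots> = ((cos t)\<^sup>2 + (sin t)\<^sup>2) * R\<^sup>2"
        by (simp only: b v distrib_right)
      finally have "(norm (c t))\<^sup>2 = R\<^sup>2" by simp
      then show ?thesis using R_pos power2_eq_imp_eq by fastforce
    qed
    have cos0: "((\<lambda>t. (cos t - 1) / t) \<longlongrightarrow> 0) (at (0::real))"
      using DERIV_cos[of "0::real"] by (simp add: DERIV_def)
    have sin0: "((\<lambda>t. sin t / t) \<longlongrightarrow> 1) (at (0::real))"
      using DERIV_sin[of "0::real"] by (simp add: DERIV_def)
    have "((\<lambda>t. ((cos t - 1) / t) *\<^sub>R b + (sin t / t) *\<^sub>R v) \<longlongrightarrow> 0 *\<^sub>R b + 1 *\<^sub>R v) (at 0)"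
      using cos0 sin0 by (intro tendsto_intros)
    moreover have "((cos t - 1) / t) *\<^sub>R b + (sin t / t) *\<^sub>R v = (c t - b) /\<^sub>R t" for t
      by (simp add: c_def scaleR_right_diff_distrib scaleR_add_right diff_divide_distrib
          scaleR_left_diff_distrib divide_inverse_commute right_diff_distrib)
    ultimately have lim: "((\<lambda>t. (c t - b) /\<^sub>R t) \<longlongrightarrow> v) (at 0)"
      by simp
    have "norm v > 0" using v R_pos by simp
    then have "\<forall>\<^sub>F t in at 0. dist ((c t - b) /\<^sub>R t) v < min \<delta> (norm v)"
      using \<delta>(1) by (intro tendstoD[OF lim]) simp
    moreover have "(c \<longlongrightarrow> cos 0 *\<^sub>R b + sin 0 *\<^sub>R v) (at 0)"
      unfolding c_def by (intro tendsto_intros)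
    then have "\<forall>\<^sub>F t in at 0. dist (c t) b < \<delta>" using \<delta>(1) tendstoD by fastforce
    moreover have "\<forall>\<^sub>F t in at (0::real). t \<noteq> 0" by (rule eventually_neq_at_within)
    ultimately have "\<forall>\<^sub>F t in at 0. dist ((c t - b) /\<^sub>R t) v < min \<delta> (norm v) \<and>
        dist (c t) b < \<delta> \<and> t \<noteq> 0"
      by eventually_elim auto
    then obtain t where t: "dist ((c t - b) /\<^sub>R t) v < \<delta>" "dist (c t) b < \<delta>" "t \<noteq> 0"
      "dist ((c t - b) /\<^sub>R t) v < norm v"
      using eventually_happens'[OF at_neq_bot] by fastforce
    have ne: "b \<noteq> c t" using t(4) by auto
    have ct: "c t \<in> cball 0 R" using nc by simp
    obtain r s where s: "0 < r" "0 < s" "s < 1"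
      "w (c t) = r * ((c t - b) \<bullet> (H (b + s *\<^sub>R (c t - b)) *v (c t - b)))"
      using chord_taylor[OF bc ct ne] G0 w_zero[OF b] by auto
    have "b + s *\<^sub>R (c t - b) \<in> cball 0 R"
      using open_chord_in_ball[OF bc ct ne s(2,3)] by simp
    moreover have "dist (b + s *\<^sub>R (c t - b)) b < \<delta>"
    proof -
      have "s * norm (c t - b) \<le> norm (c t - b)" using s by (intro mult_left_le_one_le) auto
      then show ?thesis using s t by (simp add: dist_norm)
    qed
    ultimately have "0 < (v \<bullet> (H b *v v)) *
        (((c t - b) /\<^sub>R t) \<bullet> (H (b + s *\<^sub>R (c t - b)) *v ((c t - b) /\<^sub>R t)))"
      using \<delta>(2) t(1) by blast
    moreover have "(c t - b) \<bullet> (H (b + s *\<^sub>R (c t - b)) *v (c t - b)) = 0"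
      using s w_zero[OF nc] by simp
    ultimately show False by (simp add: matrix_vector_mult_scaleR)
  qed
  show ?thesis
  proof (cases "v = 0")
    case False
    define k where "k = norm v / R"
    have k: "k \<noteq> 0" using False R_pos by (simp add: k_def)
    have "norm (v /\<^sub>R k) = R" using False R_pos by (simp add: k_def)
    then have "(v /\<^sub>R k) \<bullet> (H b *v (v /\<^sub>R k)) = 0"
      using v by (intro *) simp_all
    then show ?thesis
      using k quadratic_form_combination[of "inverse k" v 0 0 "H b"] by simp
  qed simp
qed

text \<open>Split \<open>v\<close> into a multiple of \<open>e\<close> and a tangential part. Only
  the mixed term is open: on \<open>- e + s *\<^sub>R \<tau>\<close>, an inward direction for every
  real \<open>s\<close>, the form is linear in \<open>s\<close> and nonnegative, hence zero.\<close>

lemma boundary_hessian_form_zero: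
  assumes b: "norm b = R" and e: "e \<bullet> b > 0" and G0: "G b = 0" and He: "e \<bullet> (H b *v e) = 0"
  shows "v \<bullet> (H b *v v) = 0"
proof -
  have cross: "e \<bullet> (H b *v \<tau>) + \<tau> \<bullet> (H b *v e) = 0" if \<tau>: "\<tau> \<bullet> b = 0" for \<tau>
  proof -
    define m where "m = e \<bullet> (H b *v \<tau>) + \<tau> \<bullet> (H b *v e)"
    have "0 \<le> - s * m" for s
    proof -
      have "(- e + s *\<^sub>R \<tau>) \<bullet> b < 0" using e \<tau> by (simp add: inner_diff_left inner_add_left)
      then have "0 \<le> (- e + s *\<^sub>R \<tau>) \<bullet> (H b *v (- e + s *\<^sub>R \<tau>))"
        by (rule inward_second_derivative_nonneg[OF b _ G0])
      also have "\<dots> = - s * m"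
        using He tangential_second_derivative[OF b \<tau> G0]
          quadratic_form_combination[of "-1" e s \<tau> "H b"]
        by (simp add: m_def)
      finally show ?thesis .
    qed
    from this[of 1] this[of "-1"] show ?thesis unfolding m_def by simp
  qed
  define a where "a = (v \<bullet> b) / (e \<bullet> b)"
  define \<tau> where "\<tau> = v - a *\<^sub>R e"
  have \<tau>: "\<tau> \<bullet> b = 0" using e by (simp add: \<tau>_def a_def inner_diff_left)
  have "v = a *\<^sub>R e + \<tau>" by (simp add: \<tau>_def)
  then have "v \<bullet> (H b *v v) = a * a * (e \<bullet> (H b *v e)) +
      a * (e \<bullet> (H b *v \<tau>) + \<tau> \<bullet> (H b *v e)) + \<tau> \<bullet> (H b *v \<tau>)"
    using quadratic_form_combination[of a e 1 \<tau> "H b"] by simp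
  then show ?thesis using He cross[OF \<tau>] tangential_second_derivative[OF b \<tau> G0] by simp
qed

text \<open>Polarisation needs a symmetric matrix; symmetry passes from the interior to
  \<open>b\<close> by continuity.\<close>

lemma boundary_hessian_zero:
  assumes "norm b = R" "e \<bullet> b > 0" "G b = 0" "e \<bullet> (H b *v e) = 0"
  shows "H b = 0"
proof -
  note q0 = boundary_hessian_form_zero[OF assms]
  have "H b $ i $ j - H b $ j $ i = 0" for i j
  proof (rule continuous_constant_on_closure[of "ball 0 R" "\<lambda>x. H x $ i $ j - H x $ j $ i"])
    show "continuous_on (closure (ball 0 R)) (\<lambda>x. H x $ i $ j - H x $ j $ i)"
      using cont_H R_pos by (auto intro!: continuous_intros)
    show "H x $ i $ j - H x $ j $ i = 0" if "x \<in> ball 0 R" for x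
    proof -
      have "transpose (H x) $ j $ i = H x $ j $ i"
        using hessian_symmetric[OF open_ball that td] by simp
      then show ?thesis by (simp add: transpose_def)
    qed
    show "b \<in> closure (ball 0 R)" using assms R_pos by simp
  qed
  then have "H b $ i $ j = 0" for i j
    using q0[of "axis i 1 + axis j 1"] q0[of "axis i 1"] q0[of "axis j 1"]
    by (simp add: matrix_vector_right_distrib inner_add_left inner_add_right axis_matrix_axis)
  then show ?thesis by (simp add: vec_eq_iff)
qed

text \<open>Follow the ray from \<open>x\<close> in direction \<open>e\<close> to the sphere. The
  derivative along \<open>e\<close> strictly increases on the way and is at most zero at the exit
  point, because \<open>- e\<close> is inward there; so it is negative at \<open>x\<close>.\<close>

lemma grad_neg_near_boundary:
  assumes b: "norm b = R" and e: "norm e = 1" "e \<bullet> b > 0" and H: "e \<bullet> (H b *v e) > 0"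
  shows "\<exists>\<delta>>0. \<forall>x\<in>ball 0 R. dist x b < \<delta> \<longrightarrow> G x \<bullet> e < 0"
proof -
  have bc: "b \<in> cball 0 R" using b by simp
  obtain \<delta>1 where \<delta>1: "\<delta>1 > 0" "\<And>x. x \<in> cball 0 R \<Longrightarrow> dist x b < \<delta>1 \<Longrightarrow> 0 < e \<bullet> (H x *v e)"
    using hessian_form_sign_near[OF bc, of e] H by (auto simp: zero_less_mult_iff)
  define c where "c = (e \<bullet> b) / 2"
  have c: "c > 0" using e by (simp add: c_def)
  \<comment> \<open>\<open>c\<close> bounds \<open>x \<bullet> e\<close> from below, so the exit
    time is at most \<open>dist x b * (R / c)\<close>. The whole segment then stays within distance
    \<open>\<delta>1\<close> of \<open>b\<close>.\<close>
  define \<delta> where "\<delta> = min c (\<delta>1 / (1 + R / c))"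
  have pos: "1 + R / c > 0" using c R_pos by (simp add: add_pos_pos)
  have "G x \<bullet> e < 0" if x: "x \<in> ball 0 R" "dist x b < \<delta>" for x
  proof -
    have "\<bar>(x - b) \<bullet> e\<bar> \<le> norm (x - b)" using Cauchy_Schwarz_ineq2[of "x - b" e] e by simp
    then have xe: "x \<bullet> e > c"
      using x by (simp add: \<delta>_def dist_norm inner_diff_left c_def inner_commute[of e]) linarith
    define T1 where "T1 = (R\<^sup>2 - (norm x)\<^sup>2) / (2 * c)"
    have nx: "norm x < R" using x by simp
    then have T1: "T1 > 0" using c by (simp add: T1_def power_strict_mono)
    have sq: "(norm (x + t *\<^sub>R e))\<^sup>2 = (norm x)\<^sup>2 + 2 * t * (x \<bullet> e) + t\<^sup>2" for t
    proof -
      have "e \<bullet> e = 1" using e by (simp add: norm_eq_1)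
      then show ?thesis
        by (simp only: power2_norm_eq_inner)
          (simp add: inner_add_left inner_add_right inner_commute[of e x] power2_eq_square
            distrib_left)
    qed
    have "R\<^sup>2 = (norm x)\<^sup>2 + 2 * T1 * c" using c by (simp add: T1_def field_simps)
    also have "\<dots> \<le> (norm (x + T1 *\<^sub>R e))\<^sup>2"
      unfolding sq using xe T1 by (simp add: add_increasing2)
    finally have "R \<le> norm (x + T1 *\<^sub>R e)" using power2_le_imp_le by fastforce
    moreover have "continuous_on {0..T1} (\<lambda>t. norm (x + t *\<^sub>R e))" by (intro continuous_intros)
    ultimately obtain T where T: "0 \<le> T" "T \<le> T1" "norm (x + T *\<^sub>R e) = R"
      using IVT'[of "\<lambda>t. norm (x + t *\<^sub>R e)" 0 R T1] nx T1 by auto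
    then have "T > 0" using nx by (cases "T = 0") auto
    have "T1 \<le> dist x b * (R / c)"
    proof -
      have "R - norm x \<le> dist x b" using b norm_triangle_ineq2[of b x] by (simp add: dist_norm norm_minus_commute)
      then have "(R - norm x) * (R + norm x) \<le> dist x b * (2 * R)"
        using nx R_pos by (intro mult_mono) (auto intro: add_nonneg_nonneg)
      then have "R\<^sup>2 - (norm x)\<^sup>2 \<le> dist x b * (2 * R)"
        by (simp add: power2_eq_square algebra_simps)
      then have "T1 \<le> dist x b * (2 * R) / (2 * c)"
        unfolding T1_def using c by (intro divide_right_mono) auto
      then show ?thesis by simp
    qed
    moreover have "dist x b * (1 + R / c) < \<delta>1"
      using x pos by (simp add: \<delta>_def pos_less_divide_eq)
    ultimately have dT: "dist x b + T < \<delta>1" using T by (simp add: algebra_simps)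
    let ?y = "x + T *\<^sub>R e"
    have "x \<noteq> ?y" using T nx by auto
    then obtain s where s: "0 < s" "s < 1" "(G ?y - G x) \<bullet> e = e \<bullet> (H (x + s *\<^sub>R (T *\<^sub>R e)) *v (T *\<^sub>R e))"
      using chord_MVT(2)[of x ?y e] T x by auto
    let ?z = "x + s *\<^sub>R (T *\<^sub>R e)"
    have "?z \<in> ball 0 R"
      using open_chord_in_ball[of x R ?y s] s T x \<open>x \<noteq> ?y\<close> by auto
    moreover have "dist ?z b < \<delta>1"
    proof -
      have "dist ?z b \<le> dist ?z x + dist x b" by (rule dist_triangle)
      moreover have "dist ?z x = s * T" using e s T by (simp add: dist_norm)
      moreover have "s * T \<le> T" using s T by (intro mult_left_le_one_le) auto
      ultimately show ?thesis using dT by linarith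
    qed
    ultimately have "0 < e \<bullet> (H ?z *v e)" using \<delta>1 by simp
    then have "(G ?y - G x) \<bullet> e > 0"
      using s \<open>T > 0\<close> by (simp add: matrix_vector_mult_scaleR)
    moreover have "0 \<le> G ?y \<bullet> (- e)"
    proof (rule inward_derivative_nonneg)
      have "x \<bullet> e > 0" "e \<bullet> e = 1" using xe c e by (auto simp: norm_eq_1)
      then show "- e \<bullet> ?y < 0"
        using \<open>T > 0\<close> by (simp add: inner_add_right inner_commute)
    qed (use T in simp)
    ultimately show ?thesis by (simp add: inner_diff_left)
  qed
  moreover have "\<delta> > 0" using c \<delta>1 pos by (simp add: \<delta>_def)
  ultimately show ?thesis by blast
qed

lemma boundary_alternative:
  assumes b: "norm b = R" and e: "norm e = 1" "e \<bullet> b > 0"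
  shows "(\<exists>\<delta>>0. \<forall>x\<in>ball 0 R. dist x b < \<delta> \<longrightarrow> G x \<bullet> e < 0) \<or> G b = 0 \<and> H b = 0"
proof -
  have inward: "(- e) \<bullet> b < 0" using e by simp
  have bc: "b \<in> cball 0 R" using b by simp
  have le: "G b \<bullet> e \<le> 0" using inward_derivative_nonneg[OF b inward] by simp
  show ?thesis
  proof (cases "G b \<bullet> e = 0")
    case True
    then have G0: "G b = 0" using grad_eq_0_of_tangential[OF b e(2)] by simp
    have "0 \<le> e \<bullet> (H b *v e)"
      using inward_second_derivative_nonneg[OF b inward G0]
      unfolding quadratic_form_minus .
    then show ?thesis
      using grad_neg_near_boundary[OF b e] boundary_hessian_zero[OF b e(2) G0] G0 by fastforce
  next
    case False
    have "((\<lambda>x. G x \<bullet> e) \<longlongrightarrow> G b \<bullet> e) (at b within cball 0 R)"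
      using cont_G bc by (auto simp: continuous_on_def intro: tendsto_intros)
    then have "\<forall>\<^sub>F x in at b within cball 0 R. G x \<bullet> e < 0"
      using False le by (intro order_tendstoD) auto
    then obtain \<delta> where "\<delta> > 0" "\<And>x. x \<in> cball 0 R \<Longrightarrow> x \<noteq> b \<Longrightarrow> dist x b < \<delta> \<Longrightarrow> G x \<bullet> e < 0"
      unfolding eventually_at by auto
    moreover have "x \<noteq> b" if "x \<in> ball 0 R" for x using that b by auto
    ultimately show ?thesis using ball_subset_cball[of 0 R] by blast
  qed
qed

end

section \<open>Reflections and the reflected equation\<close>

definition reflect :: "real^'N \<Rightarrow> real \<Rightarrow> real^'N \<Rightarrow> real^'N" where
  "reflect e l x = x - (2 * (x \<bullet> e - l)) *\<^sub>R e"

definition reflection_matrix :: "real^'N \<Rightarrow> real^'N^'N" where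
  "reflection_matrix e = mat 1 - 2 *\<^sub>R outer e"

lemma reflection_matrix_mult: "reflection_matrix e *v p = p - (2 * (p \<bullet> e)) *\<^sub>R e"
  by (simp add: reflection_matrix_def matrix_vector_mult_diff_rdistrib scaleR_matrix_vector_assoc[symmetric]
      outer_mult_vec inner_commute)

lemma reflect_eq: "reflect e l x = reflection_matrix e *v x + (2 * l) *\<^sub>R e"
  by (simp add: reflect_def reflection_matrix_mult algebra_simps)

lemma transpose_reflection_matrix: "transpose (reflection_matrix e) = reflection_matrix e"
  by (simp add: reflection_matrix_def outer_def transpose_def mat_def vec_eq_iff mult.commute)

lemma norm_reflection_matrix_mult:
  assumes "norm e = 1"
  shows "norm (reflection_matrix e *v p) = norm p"
proof -
  have "e \<bullet> e = 1" using assms by (simp add: norm_eq_1)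
  then show ?thesis
    by (simp add: norm_eq reflection_matrix_mult inner_diff_left inner_diff_right
        inner_commute[of e p] algebra_simps)
qed

lemma orthogonal_reflection_matrix:
  assumes "norm e = 1"
  shows "orthogonal_matrix (reflection_matrix e)"
proof -
  have "e \<bullet> e = 1" using assms by (simp add: norm_eq_1)
  then have "reflection_matrix e *v (reflection_matrix e *v p) = mat 1 *v p" for p
    by (simp add: reflection_matrix_mult inner_diff_left)
  then have "reflection_matrix e ** reflection_matrix e = mat 1"
    unfolding matrix_vector_mul_assoc by (subst matrix_eq) blast
  then show ?thesis by (simp add: orthogonal_matrix transpose_reflection_matrix)
qed

lemma norm_reflect:
  assumes "norm e = 1"
  shows "(norm (reflect e l x))\<^sup>2 = (norm x)\<^sup>2 - 4 * l * (x \<bullet> e - l)"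
proof -
  have "e \<bullet> e = 1" using assms by (simp add: norm_eq_1)
  then show ?thesis
    by (simp only: power2_norm_eq_inner reflect_def)
      (simp add: inner_diff_left inner_diff_right inner_commute[of e x] algebra_simps)
qed

lemma norm_reflect_le:
  assumes "norm e = 1" "0 \<le> l" "l \<le> x \<bullet> e"
  shows "norm (reflect e l x) \<le> norm x"
  by (rule power2_le_imp_le) (use norm_reflect[OF assms(1), of l x] assms in auto)

lemma norm_reflect_less:
  assumes "norm e = 1" "0 < l" "l < x \<bullet> e"
  shows "norm (reflect e l x) < norm x"
  by (rule power2_less_imp_less) (use norm_reflect[OF assms(1), of l x] assms in auto)

text \<open>Monotonicity is assumed one component at a time, so the components are exchanged
  successively; \<open>h T\<close> is the hybrid that agrees with \<open>b\<close> on
  \<open>T\<close> and with \<open>a\<close> elsewhere.\<close>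

lemma nondecreasing_off_component:
  assumes nd: "\<And>j. j \<noteq> i \<Longrightarrow> nondecreasing_in j \<Omega> g" and x: "x \<in> closure \<Omega>"
    and le: "\<And>j. a $ j \<le> b $ j" and i: "a $ i = b $ i"
  shows "g x a p \<le> g x b p"
proof -
  define h where "h = (\<lambda>T. \<chi> j. if j \<in> T then b $ j else a $ j)"
  have "g x a p \<le> g x (h T) p" if "finite T" for T
    using that
  proof (induction T)
    case empty
    have "h {} = a" by (simp add: h_def)
    then show ?case by simp
  next
    case (insert k T)
    have "g x (h T) p \<le> g x (h (insert k T)) p"
    proof (cases "k = i")
      case True
      then have "h (insert k T) = h T" using i by (simp add: h_def vec_eq_iff)
      then show ?thesis by simp
    next
      case False
      have "\<And>l. l \<noteq> k \<Longrightarrow> h T $ l = h (insert k T) $ l" "h T $ k \<le> h (insert k T) $ k"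
        using insert le by (auto simp: h_def)
      then show ?thesis using nd[OF False] x unfolding nondecreasing_in_def by blast
    qed
    then show ?case using insert.IH by linarith
  qed
  moreover have "h UNIV = b" by (simp add: h_def)
  ultimately show ?thesis by (metis finite)
qed

lemma twice_diff_cong:
  assumes "twice_diff S w g H" "open S" "\<And>x. x \<in> S \<Longrightarrow> g' x = g x" "\<And>x. x \<in> S \<Longrightarrow> H' x = H x"
  shows "twice_diff S w g' H'"
  unfolding twice_diff_def
proof (intro ballI conjI)
  fix x assume x: "x \<in> S"
  show "(w has_derivative (\<lambda>h. g' x \<bullet> h)) (at x)"
    using twice_diffD(1)[OF assms(1) x] assms(3)[OF x] by simp
  show "(g' has_derivative (*v) (H' x)) (at x)"
    unfolding assms(4)[OF x]
    by (rule has_derivative_transform_within_open[OF twice_diffD(2)[OF assms(1) x] assms(2) x])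
      (simp add: assms(3))
qed

section \<open>Uniform estimates from the structure conditions\<close>

locale moving_planes =
  fixes R :: real
    and F :: "'n::finite \<Rightarrow> 'N::finite second_order"
    and f :: "'n \<Rightarrow> ('n, 'N) first_order"
    and \<alpha> \<beta> :: "'n \<Rightarrow> real" and \<gamma> :: real
    and u :: "'n \<Rightarrow> real^'N \<Rightarrow> real"
  assumes R_pos: "R > 0" and \<alpha>: "0 < \<alpha> i" "\<alpha> i \<le> \<beta> i" and \<gamma>: "\<gamma> \<ge> 0"
    and H0: "orthogonally_invariant (ball 0 R) (F i) (f i)"
    and H1: "uniformly_elliptic (ball 0 R) (\<alpha> i) (\<beta> i) \<gamma> (F i)"
    and H2: "locally_lipschitz_in_gradient (ball 0 R) (f i)"
    and H3: "radially_nonincreasing (ball 0 R) (F i) (f i)"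
    and H4: "lipschitz_plus_nondecreasing_in i (ball 0 R) (f i)"
    and H5: "j \<noteq> i \<Longrightarrow> nondecreasing_in j (ball 0 R) (f i)"
    and C2: "C2_closure (ball 0 R) (u i)"
    and equation: "x \<in> ball 0 R \<Longrightarrow>
      F i x (grad (u i) x) (hessian (u i) x) + f i x (\<chi> j. u j x) (grad (u i) x) = 0"
    and pos: "x \<in> ball 0 R \<Longrightarrow> u i x > 0"
    and bdry: "norm x = R \<Longrightarrow> u i x = 0"
begin

lemma closure_ball_R: "closure (ball (0 :: real^'N) R) = cball 0 R"
  using R_pos by simp

lemma td: "twice_diff (ball 0 R) (u i) (grad (u i)) (hessian (u i))"
  using C2[of i] by (intro twice_diff_grad_hessian) (auto simp: C2_closure_def)

lemma cont_u: "continuous_on (cball 0 R) (u i)"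
  using C2[of i] by (simp add: C2_closure_def closure_ball_R)

lemma hessian_sym: "x \<in> ball 0 R \<Longrightarrow> hessian (u i) x \<in> sym_mats"
  using hessian_symmetric[OF open_ball _ td] by (simp add: sym_mats_def)

lemma C2_extension:
  obtains G H where "ball_C2 R (u i) G H"
    "\<And>x. x \<in> ball 0 R \<Longrightarrow> G x = grad (u i) x" "\<And>x. x \<in> ball 0 R \<Longrightarrow> H x = hessian (u i) x"
proof -
  obtain G H where GH: "continuous_on (cball 0 R) G" "continuous_on (cball 0 R) H"
    and eq: "\<And>x. x \<in> ball 0 R \<Longrightarrow> G x = grad (u i) x" "\<And>x. x \<in> ball 0 R \<Longrightarrow> H x = hessian (u i) x"
    using C2[of i] unfolding C2_closure_def closure_ball_R by blast
  have "twice_diff (ball 0 R) (u i) G H"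
    using twice_diff_cong[OF td open_ball] eq by blast
  then have "ball_C2 R (u i) G H"
    using R_pos cont_u GH pos bdry by unfold_locales auto
  then show ?thesis using that eq by blast
qed

lemma uniform_bounds: "\<exists>M>0. \<forall>i. \<forall>x\<in>ball 0 R. \<bar>u i x\<bar> \<le> M \<and> norm (grad (u i) x) \<le> M"
proof -
  have "\<exists>m. \<forall>x\<in>ball 0 R. \<bar>u i x\<bar> \<le> m \<and> norm (grad (u i) x) \<le> m" for i
  proof -
    obtain G H where B: "ball_C2 R (u i) G H" and G: "\<And>x. x \<in> ball 0 R \<Longrightarrow> G x = grad (u i) x"
      using C2_extension by metis
    have "bounded (u i ` cball 0 R)" "bounded (G ` cball 0 R)"
      using cont_u ball_C2.cont_G[OF B] by (auto intro!: compact_imp_bounded compact_continuous_image)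
    then obtain a b where "\<And>x. x \<in> cball 0 R \<Longrightarrow> \<bar>u i x\<bar> \<le> a" "\<And>x. x \<in> cball 0 R \<Longrightarrow> norm (G x) \<le> b"
      unfolding bounded_iff by (metis imageI real_norm_def)
    then show ?thesis using G
      by (intro exI[of _ "max a b"]) (metis ball_subset_cball max.coboundedI1 max.coboundedI2 subsetD)
  qed
  then obtain m where m: "\<And>i x. x \<in> ball 0 R \<Longrightarrow> \<bar>u i x\<bar> \<le> m i \<and> norm (grad (u i) x) \<le> m i"
    by metis
  define M where "M = 1 + (\<Sum>i\<in>UNIV. \<bar>m i\<bar>)"
  have "m i \<le> M" for i
    using member_le_sum[of i UNIV "\<lambda>i. \<bar>m i\<bar>"] by (simp add: M_def)
  moreover have "M > 0" by (simp add: M_def add_pos_nonneg sum_nonneg)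
  ultimately show ?thesis using m by (meson order_trans)
qed

text \<open>The estimate is one-sided and only claimed for ordered \<open>a\<close> and
  \<open>b\<close>: upward jumps of \<open>f i\<close> are compatible with it, downward jumps are
  not. One constant serves for the component \<open>i\<close> and for the gradient.\<close>

definition increment_bound :: "'n \<Rightarrow> real \<Rightarrow> real \<Rightarrow> bool" where
  "increment_bound i M K \<longleftrightarrow> (\<forall>x\<in>ball 0 R. \<forall>a b p q.
    (\<forall>j. a $ j \<le> b $ j \<and> \<bar>a $ j\<bar> \<le> M \<and> \<bar>b $ j\<bar> \<le> M) \<longrightarrow> norm p \<le> M \<longrightarrow> norm q \<le> M \<longrightarrow>
    f i x a p - K * (b $ i - a $ i) - K * norm (p - q) \<le> f i x b q)"

lemma increment_boundD:
  assumes "increment_bound i M K" "x \<in> ball 0 R"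
    "\<And>j. a $ j \<le> b $ j" "\<And>j. \<bar>a $ j\<bar> \<le> M" "\<And>j. \<bar>b $ j\<bar> \<le> M" "norm p \<le> M" "norm q \<le> M"
  shows "f i x a p - K * (b $ i - a $ i) - K * norm (p - q) \<le> f i x b q"
  using assms unfolding increment_bound_def by blast

lemma increment_bound_exists:
  assumes M: "M > 0"
  shows "\<exists>K\<ge>0. increment_bound i M K"
proof -
  \<comment> \<open>A radius that contains both the vectors with entries bounded by \<open>M\<close>
    and the gradients.\<close>
  define \<sigma> where "\<sigma> = (CARD('n) + 1) * M"
  have \<sigma>: "\<sigma> > 0" "M \<le> \<sigma>" using M by (auto simp: \<sigma>_def distrib_right add_pos_pos)
  have bound: "norm a \<le> \<sigma>" if "\<And>j. \<bar>a $ j\<bar> \<le> M" for a :: "real^'n"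
  proof -
    have "norm a \<le> (\<Sum>j\<in>UNIV. \<bar>a $ j\<bar>)" by (rule norm_le_l1_cart)
    also have "\<dots> \<le> (\<Sum>j\<in>(UNIV :: 'n set). M)" using that by (intro sum_mono)
    finally show ?thesis using M by (simp add: \<sigma>_def algebra_simps)
  qed
  obtain \<mu> where \<mu>: "\<mu> \<ge> 0" "\<forall>p\<in>cball 0 \<sigma>. \<forall>q\<in>cball 0 \<sigma>. \<forall>x\<in>ball 0 R. \<forall>v\<in>cball 0 \<sigma>.
      \<bar>f i x v p - f i x v q\<bar> \<le> \<mu> * norm (p - q)"
    using H2[of i] \<sigma>(1) unfolding locally_lipschitz_in_gradient_def by blast
  obtain f1 f2 where f12: "\<And>x v p. x \<in> cball 0 R \<Longrightarrow> f i x v p = f1 x v p + f2 x v p"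
    and f1: "uniformly_locally_lipschitz_in i (ball 0 R) f1"
    and f2: "nondecreasing_in i (ball 0 R) f2"
    using H4[of i] unfolding lipschitz_plus_nondecreasing_in_def closure_ball_R by blast
  obtain L where L: "L \<ge> 0" "\<forall>x\<in>ball 0 R. \<forall>p\<in>cball 0 \<sigma>. \<forall>v\<in>cball 0 \<sigma>. \<forall>w\<in>cball 0 \<sigma>.
      (\<forall>j. j \<noteq> i \<longrightarrow> v $ j = w $ j) \<longrightarrow> \<bar>f1 x v p - f1 x w p\<bar> \<le> L * \<bar>v $ i - w $ i\<bar>"
    using f1[unfolded uniformly_locally_lipschitz_in_def, THEN spec[of _ "cball 0 \<sigma>"],
        THEN spec[of _ "cball 0 \<sigma>"], THEN mp, THEN mp, OF bounded_cball bounded_cball]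
    by blast
  have "f i x a p - (L + \<mu>) * (b $ i - a $ i) - (L + \<mu>) * norm (p - q) \<le> f i x b q"
    if x: "x \<in> ball 0 R" and ab: "\<And>j. a $ j \<le> b $ j \<and> \<bar>a $ j\<bar> \<le> M \<and> \<bar>b $ j\<bar> \<le> M"
      and pq: "norm p \<le> M" "norm q \<le> M" for x a b p q
  proof -
    \<comment> \<open>The passage from \<open>a\<close> to \<open>b\<close> goes through
      \<open>c\<close>: changing component \<open>i\<close> costs the Lipschitz constant of
      \<open>f1\<close>, and changing the others only increases \<open>f i\<close>.\<close>
    define c :: "real^'n" where "c = (\<chi> j. if j = i then b $ j else a $ j)"
    have xc: "x \<in> cball 0 R" using x by simp
    have na: "norm a \<le> \<sigma>" and nb: "norm b \<le> \<sigma>" and nc: "norm c \<le> \<sigma>"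
      using ab by (auto intro!: bound simp: c_def)
    have off: "\<forall>j. j \<noteq> i \<longrightarrow> a $ j = c $ j" by (simp add: c_def)
    have "f i x c p \<le> f i x b p"
      by (rule nondecreasing_off_component[where i = i and \<Omega> = "ball 0 R"])
        (use H5 xc ab in \<open>auto simp: c_def closure_ball_R\<close>)
    moreover have "f2 x a p \<le> f2 x c p"
      using f2 off ab xc unfolding nondecreasing_in_def closure_ball_R by (simp add: c_def)
    moreover have "\<bar>f1 x a p - f1 x c p\<bar> \<le> L * (b $ i - a $ i)"
    proof -
      have "\<bar>f1 x a p - f1 x c p\<bar> \<le> L * \<bar>a $ i - c $ i\<bar>"
        using L(2) x na nc pq \<sigma> off by auto
      then show ?thesis using ab[of i] by (simp add: c_def)
    qed
    moreover have "\<bar>f i x b p - f i x b q\<bar> \<le> \<mu> * norm (p - q)"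
      using \<mu>(2) x nb pq \<sigma> by auto
    moreover have "0 \<le> \<mu> * (b $ i - a $ i)" "0 \<le> L * norm (p - q)"
      using \<mu> L ab by auto
    ultimately show ?thesis
      using f12[OF xc, of a p] f12[OF xc, of c p] by (simp add: algebra_simps)
  qed
  then show ?thesis
    using L(1) \<mu>(1) unfolding increment_bound_def by (intro exI[of _ "L + \<mu>"]) auto
qed

text \<open>The reflected solution is a supersolution of the equation of \<open>u\<close>, because reflection in the
  hyperplane decreases \<open>|x|\<close>.\<close>

lemma reflected_difference_inequality:
  obtains K where "K \<ge> 0" "\<And>e l x. norm e = 1 \<Longrightarrow> 0 \<le> l \<Longrightarrow> x \<in> ball 0 R \<Longrightarrow> l \<le> x \<bullet> e \<Longrightarrow>
      (\<And>j. u j x \<le> u j (reflect e l x)) \<Longrightarrow>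
      pucci_min (\<alpha> i) (\<beta> i) (reflection_matrix e ** hessian (u i) (reflect e l x) ** reflection_matrix e
          - hessian (u i) x)
        \<le> K * norm (reflection_matrix e *v grad (u i) (reflect e l x) - grad (u i) x)
          + K * (u i (reflect e l x) - u i x)"
proof -
  obtain M where M: "M > 0" "\<And>i x. x \<in> ball 0 R \<Longrightarrow> \<bar>u i x\<bar> \<le> M"
      "\<And>i x. x \<in> ball 0 R \<Longrightarrow> norm (grad (u i) x) \<le> M"
    using uniform_bounds by blast
  obtain K where K: "K \<ge> 0" "increment_bound i M K"
    using increment_bound_exists[OF M(1)] by blast
  show ?thesis
  proof (rule that[of "K + \<gamma>"])
    fix e x :: "real^'N" and l :: real
    assume e: "norm e = 1" and l: "0 \<le> l" "l \<le> x \<bullet> e" and x: "x \<in> ball 0 R"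
      and le: "\<And>j. u j x \<le> u j (reflect e l x)"
    define Q where "Q = reflection_matrix e"
    define y where "y = reflect e l x"
    have Q: "orthogonal_matrix Q" "transpose Q = Q"
      using e by (simp_all add: Q_def orthogonal_reflection_matrix transpose_reflection_matrix)
    have yx: "norm y \<le> norm x" using norm_reflect_le[OF e l] by (simp add: y_def)
    then have y: "y \<in> ball 0 R" using x by simp
    define p where "p = Q *v grad (u i) y"
    define X where "X = Q ** hessian (u i) y ** Q"
    have X: "X \<in> sym_mats"
      using hessian_sym[OF y, of i] Q(2)
      by (simp add: X_def sym_mats_def matrix_transpose_mul matrix_mul_assoc)
    have "F i y p X + f i y (\<chi> j. u j y) p = 0"
      using H0[of i] Q hessian_sym[OF y, of i] equation[OF y, of i] y
      unfolding orthogonally_invariant_def closure_ball_R p_def X_def by fastforce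
    then have super: "F i x p X + f i x (\<chi> j. u j y) p \<le> 0"
      using H3[of i] X x y yx unfolding radially_nonincreasing_def closure_ball_R
      by (metis ball_subset_cball subsetD)
    have "pucci_min (\<alpha> i) (\<beta> i) (X - hessian (u i) x) - \<gamma> * norm (p - grad (u i) x)
        \<le> F i x p X - F i x (grad (u i) x) (hessian (u i) x)"
      using H1[of i] X hessian_sym[OF x, of i] x unfolding uniformly_elliptic_def by blast
    moreover have "norm p \<le> M"
      using M(3)[OF y] e by (simp add: p_def Q_def norm_reflection_matrix_mult)
    then have "f i x (\<chi> j. u j x) (grad (u i) x) - K * (u i y - u i x) - K * norm (grad (u i) x - p)
        \<le> f i x (\<chi> j. u j y) p"
      using increment_boundD[OF K(2) x, of "\<chi> j. u j x" "\<chi> j. u j y" "grad (u i) x" p] M x y le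
      by (simp add: y_def)
    \<comment> \<open>This slack lets the single constant \<open>K + \<gamma>\<close> stand in front
      of both terms.\<close>
    moreover have "0 \<le> \<gamma> * (u i y - u i x)" using \<gamma> le by (simp add: y_def)
    ultimately have "pucci_min (\<alpha> i) (\<beta> i) (X - hessian (u i) x)
        \<le> (K + \<gamma>) * norm (p - grad (u i) x) + (K + \<gamma>) * (u i y - u i x)"
      using super equation[OF x, of i] norm_minus_commute[of p "grad (u i) x"]
      by (simp add: algebra_simps)
    then show "pucci_min (\<alpha> i) (\<beta> i) (reflection_matrix e ** hessian (u i) (reflect e l x) **
        reflection_matrix e - hessian (u i) x)
      \<le> (K + \<gamma>) * norm (reflection_matrix e *v grad (u i) (reflect e l x) - grad (u i) x)
        + (K + \<gamma>) * (u i (reflect e l x) - u i x)"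
      by (simp add: X_def p_def Q_def y_def)
  qed (use K \<gamma> in simp)
qed

text \<open>Where gradient and Hessian vanish, the equation forces \<open>f i (y, u y, 0)\<close> to be asymptotically nonnegative as
  \<open>y\<close> tends to \<open>b\<close>. Monotonicity in \<open>|x|\<close> and in \<open>u\<close> carries this to all of the ball, up to
  \<open>K * u i\<close>, so that the Hopf lemma applies to \<open>u i\<close> at \<open>b\<close>. No continuity of \<open>f\<close> in \<open>u\<close> is
  available.\<close>

lemma no_flat_boundary_point:
  assumes b: "norm b = R" and B: "ball_C2 R (u i) G H"
    and Ge: "\<And>x. x \<in> ball 0 R \<Longrightarrow> G x = grad (u i) x"
    and He: "\<And>x. x \<in> ball 0 R \<Longrightarrow> H x = hessian (u i) x"
    and G0: "G b = 0" and H0: "H b = 0"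
  shows False
proof -
  interpret B: ball_C2 R "u i" G H by (fact B)
  have bc: "b \<in> cball 0 R" using b by simp
  obtain M where M: "M > 0" "\<And>i x. x \<in> ball 0 R \<Longrightarrow> \<bar>u i x\<bar> \<le> M"
      "\<And>i x. x \<in> ball 0 R \<Longrightarrow> norm (grad (u i) x) \<le> M"
    using uniform_bounds by blast
  obtain K where K: "K \<ge> 0" "increment_bound i M K"
    using increment_bound_exists[OF M(1)] by blast
  have F0: "F i x 0 0 = 0" if "x \<in> cball 0 R" for x
    using H1[of i] that unfolding uniformly_elliptic_def closure_ball_R by blast
  have zero_sym: "(0 :: real^'N^'N) \<in> sym_mats"
    by (simp add: sym_mats_def transpose_def vec_eq_iff)
  define D where "D = CARD('N) * CARD('N) * \<beta> i"
  have F_upper: "F i y (G y) (H y) \<le> D * norm (H y) + \<gamma> * norm (G y)" if y: "y \<in> ball 0 R" for y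
  proof -
    have "F i y (G y) (H y) - F i y 0 0 \<le> pucci_max (\<alpha> i) (\<beta> i) (H y - 0) + \<gamma> * norm (G y - 0)"
      using H1[of i] zero_sym hessian_sym[OF y, of i] y He[OF y]
      unfolding uniformly_elliptic_def by metis
    then show ?thesis
      using F0[of y] y pucci_max_le[OF \<alpha>(1)[of i] \<alpha>(2)[of i], of "H y"] by (simp add: D_def)
  qed
  have f_lower: "- K * u i x \<le> f i x (\<chi> j. u j x) 0" if x: "x \<in> ball 0 R" for x
  proof (rule tendsto_upperbound)
    let ?y = "\<lambda>t::real. t *\<^sub>R b"
    have y_in: "?y t \<in> ball 0 R" if "0 < t" "t < 1" for t using that b R_pos by simp
    have lim: "((\<lambda>t. ?y t) \<longlongrightarrow> b) (at_left 1)"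
      by (rule tendsto_eq_intros refl | simp)+
    have ev01: "\<forall>\<^sub>F t in at_left (1::real). 0 < t \<and> t < 1"
      using eventually_at_left_real[of 0 "1::real"] by (simp add: conj_commute greaterThanLessThan_iff)
    then have ev_in: "\<forall>\<^sub>F t in at_left 1. ?y t \<in> cball 0 R"
      by eventually_elim (use y_in in \<open>auto simp: less_imp_le\<close>)
    have limG: "((\<lambda>t. G (?y t)) \<longlongrightarrow> 0) (at_left 1)"
      using continuous_on_tendsto_compose[OF B.cont_G lim bc ev_in] G0 by simp
    have limH: "((\<lambda>t. H (?y t)) \<longlongrightarrow> 0) (at_left 1)"
      using continuous_on_tendsto_compose[OF B.cont_H lim bc ev_in] H0 by simp
    have limu: "((\<lambda>t. u j (?y t)) \<longlongrightarrow> 0) (at_left 1)" for j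
      using continuous_on_tendsto_compose[OF cont_u lim bc ev_in, of j] bdry[OF b] by simp
    have "((\<lambda>t. - D * norm (H (?y t)) - (\<gamma> + K) * norm (G (?y t)) - K * (u i x - u i (?y t)))
        \<longlongrightarrow> - D * norm (0 :: real^'N^'N) - (\<gamma> + K) * norm (0 :: real^'N) - K * (u i x - 0)) (at_left 1)"
      by (intro tendsto_intros limG limH limu)
    then show "((\<lambda>t. - D * norm (H (?y t)) - (\<gamma> + K) * norm (G (?y t)) - K * (u i x - u i (?y t)))
        \<longlongrightarrow> - K * u i x) (at_left 1)" by simp
    \<comment> \<open>All components tend to zero along the radius towards \<open>b\<close> and are
      positive at \<open>x\<close>, so the ordering required by \<open>increment_bound\<close> holds
      eventually.\<close>
    have "\<forall>\<^sub>F t in at_left 1. \<forall>j. u j (?y t) < u j x"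
      using order_tendstoD(2)[OF limu pos[OF x]] by (intro eventually_all_finite) auto
    moreover have "((\<lambda>t. norm (?y t)) \<longlongrightarrow> norm b) (at_left 1)"
      by (intro tendsto_intros lim)
    then have "\<forall>\<^sub>F t in at_left 1. norm x < norm (?y t)"
      using x b by (intro order_tendstoD) auto
    ultimately show "\<forall>\<^sub>F t in at_left 1. - D * norm (H (?y t)) - (\<gamma> + K) * norm (G (?y t))
        - K * (u i x - u i (?y t)) \<le> f i x (\<chi> j. u j x) 0"
      using ev01
    proof eventually_elim
      case (elim t)
      then have y: "?y t \<in> ball 0 R" and uy: "\<And>j. u j (?y t) \<le> u j x" and nxy: "norm x \<le> norm (?y t)"
        using y_in by (auto simp: less_imp_le)
      have "F i (?y t) 0 0 + f i (?y t) (\<chi> j. u j x) 0 \<le> F i x 0 0 + f i x (\<chi> j. u j x) 0"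
        using H3[of i] zero_sym x y nxy unfolding radially_nonincreasing_def closure_ball_R
        by (metis ball_subset_cball subsetD)
      then have "f i (?y t) (\<chi> j. u j x) 0 \<le> f i x (\<chi> j. u j x) 0"
        using F0 x y by simp
      moreover have "f i (?y t) (\<chi> j. u j (?y t)) (G (?y t)) - K * (u i x - u i (?y t))
          - K * norm (G (?y t)) \<le> f i (?y t) (\<chi> j. u j x) 0"
        using increment_boundD[OF K(2) y, of "\<chi> j. u j (?y t)" "\<chi> j. u j x" "G (?y t)" 0] M x y uy Ge[OF y] by simp
      moreover have "F i (?y t) (G (?y t)) (H (?y t)) + f i (?y t) (\<chi> j. u j (?y t)) (G (?y t)) = 0"
        using equation[OF y, of i] Ge[OF y] He[OF y] by simp
      ultimately show ?case using F_upper[OF y] by (simp add: algebra_simps)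
    qed
  qed simp
  have ineq: "pucci_min (\<alpha> i) (\<beta> i) (H x) \<le> (\<gamma> + K) * norm (G x) + K * u i x" if x: "x \<in> ball 0 R" for x
  proof -
    have "pucci_min (\<alpha> i) (\<beta> i) (H x - 0) - \<gamma> * norm (G x - 0) \<le> F i x (G x) (H x) - F i x 0 0"
      using H1[of i] zero_sym hessian_sym[OF x, of i] x He[OF x]
      unfolding uniformly_elliptic_def by metis
    moreover have "f i x (\<chi> j. u j x) 0 - K * norm (G x) \<le> f i x (\<chi> j. u j x) (G x)"
      using increment_boundD[OF K(2) x, of "\<chi> j. u j x" "\<chi> j. u j x" 0 "G x"] M x Ge[OF x] by simp
    moreover have "F i x (G x) (H x) + f i x (\<chi> j. u j x) (G x) = 0"
      using equation[OF x, of i] Ge[OF x] He[OF x] by simp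
    ultimately show ?thesis using F0[of x] f_lower[OF x] x by (simp add: algebra_simps)
  qed
  have "\<exists>c>0. \<forall>t. 0 < t \<and> t \<le> 1/2 \<longrightarrow> c * t \<le> u i (b + t *\<^sub>R (0 - b))"
    using \<gamma> K b pos by (intro hopf_lemma[OF \<alpha> _ _ R_pos B.td ineq cont_u]) auto
  then obtain c where c: "c > 0" "\<And>t. 0 < t \<Longrightarrow> t \<le> 1/2 \<Longrightarrow> c * t \<le> u i (b + t *\<^sub>R (0 - b))"
    by blast
  have "(G \<longlongrightarrow> 0) (at b within cball 0 R)"
    using B.cont_G bc G0 unfolding continuous_on_def by force
  \<comment> \<open>The threshold \<open>c / R\<close> makes \<open>u i\<close> smaller than
    \<open>c * t\<close> at distance \<open>t * R\<close> from \<open>b\<close>, contradicting the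
    linear growth.\<close>
  then have "\<forall>\<^sub>F x in at b within cball 0 R. dist (G x) 0 < c / R"
    using c R_pos by (intro tendstoD) auto
  then obtain \<delta> where \<delta>: "\<delta> > 0" "\<And>x. x \<in> cball 0 R \<Longrightarrow> x \<noteq> b \<Longrightarrow> dist x b < \<delta> \<Longrightarrow> norm (G x) < c / R"
    unfolding eventually_at by (auto simp: dist_norm)
  obtain t where t: "t > 0" "t < 1/2" "t * norm b < \<delta>"
    using small_step[of "1/2" \<delta> b] \<delta> by auto
  let ?y = "b + t *\<^sub>R (0 - b)"
  have "?y = (1 - t) *\<^sub>R b" by (simp add: algebra_simps)
  then have y: "?y \<in> cball 0 R" using b t R_pos by simp
  have yb: "b \<noteq> ?y" using t b R_pos by auto
  obtain s where s: "0 < s" "s < 1" "u i ?y - u i b = G (b + s *\<^sub>R (?y - b)) \<bullet> (?y - b)"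
    using B.chord_MVT(1)[OF bc y yb] by blast
  let ?z = "b + s *\<^sub>R (?y - b)"
  have "?z \<in> ball 0 R" using open_chord_in_ball[OF bc y yb s(1,2)] .
  moreover have "?z \<noteq> b" using s yb by auto
  moreover have "dist ?z b < \<delta>"
  proof -
    have "s * (t * norm b) \<le> t * norm b" using s t by (intro mult_left_le_one_le) auto
    moreover have "dist ?z b = s * (t * norm b)" using s t by (simp add: dist_norm)
    ultimately show ?thesis using t by linarith
  qed
  ultimately have "norm (G ?z) < c / R" using \<delta>(2) by (meson ball_subset_cball subsetD)
  have "c * t \<le> u i ?y" using c(2)[of t] t by simp
  also have "\<dots> = G ?z \<bullet> (?y - b)" using s bdry[OF b] by simp
  also have "\<dots> \<le> norm (G ?z) * norm (?y - b)" by (rule norm_cauchy_schwarz)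
  also have "\<dots> < c / R * norm (?y - b)"
    using \<open>norm (G ?z) < c / R\<close> yb by (intro mult_strict_right_mono) auto
  also have "\<dots> = c * t" using t b R_pos by simp
  finally show False by simp
qed

end

section \<open>Moving planes\<close>

context moving_planes begin

lemma grad_neg_near_sphere:
  assumes b: "norm b = R" and e: "norm e = 1" "e \<bullet> b > 0"
  shows "\<exists>\<delta>>0. \<forall>x\<in>ball 0 R. dist x b < \<delta> \<longrightarrow> grad (u i) x \<bullet> e < 0"
proof -
  obtain G H where B: "ball_C2 R (u i) G H"
    and eq: "\<And>x. x \<in> ball 0 R \<Longrightarrow> G x = grad (u i) x" "\<And>x. x \<in> ball 0 R \<Longrightarrow> H x = hessian (u i) x"
    using C2_extension by metis
  then show ?thesis
    using ball_C2.boundary_alternative[OF B b e] no_flat_boundary_point[OF b B] by fastforce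
qed

definition reflected_ge :: "real^'N \<Rightarrow> real \<Rightarrow> 'n \<Rightarrow> bool" where
  "reflected_ge e l i \<longleftrightarrow> (\<forall>x\<in>ball 0 R. l < x \<bullet> e \<longrightarrow> u i x \<le> u i (reflect e l x))"

text \<open>All components must be ordered even to treat one of them, because \<open>f i\<close> is
  compared at the full vectors.\<close>

lemma reflected_strict:
  assumes e: "norm e = 1" and l: "0 < l" "l < R" and ge: "\<And>i. reflected_ge e l i"
  shows reflected_greater: "\<And>x. x \<in> ball 0 R \<Longrightarrow> l < x \<bullet> e \<Longrightarrow> u i x < u i (reflect e l x)"
    and grad_neg_on_plane: "\<And>x. x \<in> ball 0 R \<Longrightarrow> x \<bullet> e = l \<Longrightarrow> grad (u i) x \<bullet> e < 0"
proof -
  have ee: "e \<bullet> e = 1" using e by (simp add: norm_eq_1)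
  define Q where "Q = reflection_matrix e"
  define w where "w = (\<lambda>x. u i (reflect e l x) - u i x)"
  define g where "g = (\<lambda>x. Q *v grad (u i) (reflect e l x) - grad (u i) x)"
  define H where "H = (\<lambda>x. Q ** hessian (u i) (reflect e l x) ** Q - hessian (u i) x)"
  \<comment> \<open>\<open>W\<close> also contains the part of the hyperplane inside the ball, where
    \<open>w\<close> vanishes and is still differentiated, while the differential inequality is
    needed only in the open cap \<open>D\<close>.\<close>
  define W where "W = {x \<in> ball 0 R. reflect e l x \<in> ball 0 R}"
  define D where "D = {x \<in> ball 0 R. l < x \<bullet> e}"
  have tdW: "twice_diff W w g H"
  proof -
    have "twice_diff W (\<lambda>x. u i (reflect e l x)) (\<lambda>x. Q *v grad (u i) (reflect e l x))
        (\<lambda>x. Q ** hessian (u i) (reflect e l x) ** Q)"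
      using twice_diff_subset[OF twice_diff_affine[OF td transpose_reflection_matrix], of W e "(2 * l) *\<^sub>R e"]
      unfolding reflect_eq Q_def W_def by auto
    moreover have "twice_diff W (u i) (grad (u i)) (hessian (u i))"
      by (rule twice_diff_subset[OF td]) (auto simp: W_def)
    ultimately show ?thesis
      using twice_diff_diff_scaled[where c = 1] unfolding w_def g_def H_def by fastforce
  qed
  have in_W: "x \<in> W" if "x \<in> ball 0 R" "l \<le> x \<bullet> e" for x
    using norm_reflect_le[OF e _ that(2)] l that by (simp add: W_def)
  then have "D \<subseteq> W" by (auto simp: D_def)
  then have tdD: "twice_diff D w g H" using tdW twice_diff_subset by blast
  have D_Int: "D = ball 0 R \<inter> {x. e \<bullet> x > l}" by (auto simp: D_def inner_commute)
  have "open D" unfolding D_Int by (intro open_Int open_ball open_halfspace_gt)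
  have "connected D"
    unfolding D_Int by (intro convex_connected convex_Int convex_ball convex_halfspace_gt)
  obtain K where K: "K \<ge> 0" "\<And>e l x. norm e = 1 \<Longrightarrow> 0 \<le> l \<Longrightarrow> x \<in> ball 0 R \<Longrightarrow> l \<le> x \<bullet> e \<Longrightarrow>
      (\<And>j. u j x \<le> u j (reflect e l x)) \<Longrightarrow>
      pucci_min (\<alpha> i) (\<beta> i) (reflection_matrix e ** hessian (u i) (reflect e l x) ** reflection_matrix e
          - hessian (u i) x)
        \<le> K * norm (reflection_matrix e *v grad (u i) (reflect e l x) - grad (u i) x)
          + K * (u i (reflect e l x) - u i x)"
    using reflected_difference_inequality by metis
  have ineq: "pucci_min (\<alpha> i) (\<beta> i) (H x) \<le> K * norm (g x) + K * w x" if "x \<in> D" for x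
    using K(2)[OF e, of l x] that l ge unfolding H_def g_def w_def Q_def D_def reflected_ge_def by simp
  have nonneg: "0 \<le> w x" if "x \<in> D" for x
    using ge that unfolding reflected_ge_def D_def w_def by simp
  have w_pos: "0 < w x" if x: "x \<in> D" for x
  proof (rule ccontr)
    assume "\<not> 0 < w x"
    then have "w x = 0" using nonneg[OF x] by simp
    then have w0: "w y = 0" if "y \<in> D" for y
      using strong_maximum_principle[OF \<alpha>(1)[of i] \<alpha>(2)[of i] K(1) K(1) \<open>open D\<close> \<open>connected D\<close> tdD ineq nonneg x]
        that by blast
    \<comment> \<open>The tip \<open>R *\<^sub>R e\<close> of the cap excludes that \<open>w\<close>
      vanishes identically: \<open>u i\<close> is zero there, but positive at the reflected point,
      which is interior.\<close>
    let ?y = "\<lambda>t. (t * R) *\<^sub>R e"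
    have lim: "(?y \<longlongrightarrow> R *\<^sub>R e) (at_left 1)"
      by (rule tendsto_eq_intros refl | simp)+
    have ev: "\<forall>\<^sub>F t in at_left (1::real). l / R < t \<and> t < 1"
      using eventually_at_left_real[of "l / R" "1::real"] l by (simp add: greaterThanLessThan_iff)
    have yD: "?y t \<in> D" if "l / R < t" "t < 1" for t
    proof -
      have "0 < l / R" using l by simp
      then have "0 < t" using that by linarith
      moreover have "l < t * R" using that R_pos by (simp add: pos_divide_less_eq)
      ultimately show ?thesis using that R_pos e ee by (simp add: D_def)
    qed
    have "\<forall>\<^sub>F t in at_left 1. ?y t \<in> cball 0 R"
      using ev by eventually_elim (use yD in \<open>force simp: D_def\<close>)
    then have "((\<lambda>t. u i (?y t)) \<longlongrightarrow> u i (R *\<^sub>R e)) (at_left 1)"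
      using e R_pos by (intro continuous_on_tendsto_compose[OF cont_u lim]) auto
    moreover have "((\<lambda>t. u i (reflect e l (?y t))) \<longlongrightarrow> u i (reflect e l (R *\<^sub>R e))) (at_left 1)"
    proof (rule continuous_on_tendsto_compose[OF cont_u])
      show "((\<lambda>t. reflect e l (?y t)) \<longlongrightarrow> reflect e l (R *\<^sub>R e)) (at_left 1)"
        unfolding reflect_def by (intro tendsto_intros lim)
      show "reflect e l (R *\<^sub>R e) \<in> cball 0 R"
        using norm_reflect_le[OF e, of l "R *\<^sub>R e"] l e ee by simp
      show "\<forall>\<^sub>F t in at_left 1. reflect e l (?y t) \<in> cball 0 R"
        using ev by eventually_elim (use yD \<open>D \<subseteq> W\<close> in \<open>force simp: W_def\<close>)
    qed
    ultimately have "((\<lambda>t. w (?y t)) \<longlongrightarrow> u i (reflect e l (R *\<^sub>R e)) - u i (R *\<^sub>R e)) (at_left 1)"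
      unfolding w_def by (intro tendsto_diff)
    moreover have "\<forall>\<^sub>F t in at_left 1. w (?y t) = 0"
      using ev by eventually_elim (use yD w0 in blast)
    then have "((\<lambda>t. w (?y t)) \<longlongrightarrow> 0) (at_left 1)" by (rule tendsto_eventually)
    ultimately have "u i (reflect e l (R *\<^sub>R e)) - u i (R *\<^sub>R e) = 0"
      by (intro tendsto_unique[of "at_left (1::real)"]) auto
    moreover have "reflect e l (R *\<^sub>R e) \<in> ball 0 R"
      using norm_reflect_less[OF e l(1), of "R *\<^sub>R e"] l e ee by simp
    then have "u i (reflect e l (R *\<^sub>R e)) > 0" by (rule pos)
    moreover have "u i (R *\<^sub>R e) = 0" using e R_pos by (intro bdry) simp
    ultimately show False by simp
  qed
  then show "u i x < u i (reflect e l x)" if "x \<in> ball 0 R" "l < x \<bullet> e" for x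
    using that by (simp add: w_def D_def)
  show "grad (u i) x \<bullet> e < 0" if x: "x \<in> ball 0 R" "x \<bullet> e = l" for x
  proof -
    \<comment> \<open>Points of the closed ball of radius \<rho> about \<open>y\<close> are within
      \<open>2 * \<rho>\<close> of \<open>x\<close>, hence inside the domain. This ball touches the
      hyperplane at \<open>x\<close>.\<close>
    define \<rho> where "\<rho> = (R - norm x) / 3"
    have \<rho>: "\<rho> > 0" using x by (simp add: \<rho>_def)
    define y where "y = x + \<rho> *\<^sub>R e"
    have near: "z \<in> ball 0 R \<and> l \<le> z \<bullet> e" if "dist y z \<le> \<rho>" for z
    proof
      have "norm z \<le> norm x + norm (y - x) + norm (z - y)"
        using norm_triangle_ineq[of x "y - x"] norm_triangle_ineq[of y "z - y"] by simp
      also have "\<dots> \<le> norm x + \<rho> + \<rho>" using that e \<rho> by (simp add: y_def dist_norm norm_minus_commute)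
      also have "\<dots> < R" using \<rho> by (simp add: \<rho>_def field_simps)
      finally show "z \<in> ball 0 R" by simp
      have "\<bar>(y - z) \<bullet> e\<bar> \<le> \<rho>" using Cauchy_Schwarz_ineq2[of "y - z" e] e that by (simp add: dist_norm)
      moreover have "(y - z) \<bullet> e = l + \<rho> - z \<bullet> e"
        using ee x by (simp add: y_def inner_diff_left inner_add_left)
      ultimately show "l \<le> z \<bullet> e" by linarith
    qed
    have "ball y \<rho> \<subseteq> D"
    proof
      fix z assume z: "z \<in> ball y \<rho>"
      have "(y - z) \<bullet> e \<le> norm (y - z)" using norm_cauchy_schwarz[of "y - z" e] e by simp
      moreover have "(y - z) \<bullet> e = l + \<rho> - z \<bullet> e"
        using ee x by (simp add: y_def inner_diff_left inner_add_left)
      ultimately have "l < z \<bullet> e" using z by (simp add: dist_norm)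
      then show "z \<in> D" using near[of z] z by (simp add: D_def)
    qed
    moreover have "cball y \<rho> \<subseteq> W" using near in_W by auto
    then have "continuous_on (cball y \<rho>) w"
      using twice_diff_continuous_on[OF tdW] continuous_on_subset by blast
    moreover have "dist y x = \<rho>" using e \<rho> by (simp add: y_def dist_norm)
    ultimately have "\<exists>c>0. \<forall>t. 0 < t \<and> t \<le> 1/2 \<longrightarrow> c * t \<le> w (x + t *\<^sub>R (y - x))"
      using tdD twice_diff_subset ineq w_pos
      by (intro hopf_lemma[OF \<alpha>(1)[of i] \<alpha>(2)[of i] K(1) K(1) \<rho>, where g = g and H = H]) blast+
    then obtain c where c: "c > 0" "\<And>t. 0 < t \<Longrightarrow> t \<le> 1/2 \<Longrightarrow> c * t \<le> w (x + t *\<^sub>R (y - x))"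
      by blast
    have rx: "reflect e l x = x" using x by (simp add: reflect_def)
    have xW: "x \<in> W" using in_W x by simp
    have "c \<le> g x \<bullet> (y - x)"
    proof (rule real_derivative_ge)
      show "((\<lambda>s. w (x + s *\<^sub>R (y - x))) has_real_derivative g x \<bullet> (y - x)) (at 0)"
        using twice_diff_line(1)[OF tdW, of x 0 "y - x"] xW by simp
      show "w (x + 0 *\<^sub>R (y - x)) + c * t \<le> w (x + t *\<^sub>R (y - x))" if "0 < t" "t \<le> 1/2" for t
        using c(2)[OF that] rx by (simp add: w_def)
    qed simp
    also have "g x \<bullet> (y - x) = \<rho> * (- 2 * (grad (u i) x \<bullet> e))"
      using ee by (simp add: g_def rx Q_def reflection_matrix_mult y_def inner_diff_left)
    finally show ?thesis using c \<rho> by (smt (verit) mult_nonneg_nonneg zero_less_mult_iff)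
  qed
qed

text \<open>The case \<open>l = R\<close> is included, with a vacuous ordering hypothesis: the
  hyperplane then meets the closed ball only on the sphere. Thus starting the planes is a special
  case of continuing them.\<close>

lemma grad_neg_near_plane:
  assumes e: "norm e = 1" and l: "0 < l" and ge: "\<And>i. l < R \<Longrightarrow> reflected_ge e l i"
    and x: "x \<in> cball 0 R" "x \<bullet> e = l"
  shows "\<exists>\<delta>>0. \<forall>y\<in>ball 0 R. dist y x < \<delta> \<longrightarrow> grad (u i) y \<bullet> e < 0"
proof (cases "norm x = R")
  case True
  then show ?thesis using grad_neg_near_sphere[OF True e] l x by (simp add: inner_commute)
next
  case False
  then have xb: "x \<in> ball 0 R" using x by simp
  have "l \<le> norm x" using norm_cauchy_schwarz[of x e] e x by simp
  then have "grad (u i) x \<bullet> e < 0"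
    using grad_neg_on_plane[OF e l _ ge xb x(2)] xb by simp
  moreover have "isCont (\<lambda>y. grad (u i) y \<bullet> e) x"
    using twice_diffD(2)[OF td xb, of i] by (auto intro!: continuous_intros dest: has_derivative_continuous)
  ultimately have "\<forall>\<^sub>F y in at x. grad (u i) y \<bullet> e < 0"
    unfolding isCont_def by (intro order_tendstoD)
  then obtain \<delta> where "\<delta> > 0" "\<And>y. y \<noteq> x \<Longrightarrow> dist y x < \<delta> \<Longrightarrow> grad (u i) y \<bullet> e < 0"
    unfolding eventually_at by auto
  then show ?thesis using \<open>grad (u i) x \<bullet> e < 0\<close> by metis
qed

lemma decreasing_along_segment:
  assumes sub: "x \<in> S" "x - t *\<^sub>R e \<in> S" "convex S" "S \<subseteq> ball 0 R" and t: "0 < t"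
    and neg: "\<And>y. y \<in> S \<Longrightarrow> grad (u i) y \<bullet> e < 0"
  shows "u i x < u i (x - t *\<^sub>R e)"
proof -
  have seg: "x + s *\<^sub>R (- e) \<in> S" if "0 \<le> s" "s \<le> t" for s
  proof -
    have "(1 - s / t) *\<^sub>R x + (s / t) *\<^sub>R (x - t *\<^sub>R e) \<in> S"
      by (rule convexD_alt) (use that t sub in auto)
    then show ?thesis using t by (simp add: algebra_simps)
  qed
  have "\<exists>s. 0 < s \<and> s < t \<and> u i (x + t *\<^sub>R (- e)) - u i (x + 0 *\<^sub>R (- e)) =
      (t - 0) * (grad (u i) (x + s *\<^sub>R (- e)) \<bullet> (- e))"
    by (intro MVT2 twice_diff_line(1)[OF td] subsetD[OF sub(4)] seg t)
  then obtain s where s: "0 < s" "s < t"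
    "u i (x - t *\<^sub>R e) - u i x = t * - (grad (u i) (x + s *\<^sub>R (- e)) \<bullet> e)" by auto
  have "grad (u i) (x + s *\<^sub>R (- e)) \<bullet> e < 0" using neg seg s by simp
  then have "u i (x - t *\<^sub>R e) - u i x > 0" using s t by (simp add: mult_pos_neg)
  then show ?thesis by simp
qed

lemma reflected_ge_closed:
  assumes e: "norm e = 1" and l: "0 \<le> l" "l < R" and ge: "\<And>k. l < k \<Longrightarrow> k < R \<Longrightarrow> reflected_ge e k i"
  shows "reflected_ge e l i"
  unfolding reflected_ge_def
proof (intro ballI impI)
  fix x assume x: "x \<in> ball 0 R" "l < x \<bullet> e"
  have ev: "\<forall>\<^sub>F k in at_right l. l < k \<and> k < R \<and> k < x \<bullet> e"
    using eventually_at_right_real[of l "min R (x \<bullet> e)"] l x by simp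
  have rin: "reflect e k x \<in> cball 0 R" if "l \<le> k" "k < x \<bullet> e" for k
    using norm_reflect_le[OF e, of k x] that l x by simp
  have "((\<lambda>k. u i (reflect e k x)) \<longlongrightarrow> u i (reflect e l x)) (at_right l)"
  proof (rule continuous_on_tendsto_compose[OF cont_u])
    show "((\<lambda>k. reflect e k x) \<longlongrightarrow> reflect e l x) (at_right l)"
      unfolding reflect_def by (intro tendsto_intros)
    show "\<forall>\<^sub>F k in at_right l. reflect e k x \<in> cball 0 R"
      using ev by eventually_elim (use rin in auto)
  qed (use rin x in simp)
  moreover have "\<forall>\<^sub>F k in at_right l. u i x \<le> u i (reflect e k x)"
    using ev by eventually_elim (use ge x in \<open>auto simp: reflected_ge_def\<close>)
  ultimately show "u i x \<le> u i (reflect e l x)"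
    by (rule tendsto_lowerbound) simp
qed

text \<open>Compactness replaces a maximum principle in thin domains. Violations for planes
  approaching \<open>l\<close> accumulate at a point \<open>z\<close>. Off the limiting plane,
  \<open>z\<close> contradicts the strict inequality in the ball or positivity of \<open>u i\<close>
  at the reflection of a sphere point; on the plane, it contradicts monotonicity of
  \<open>u i\<close> along short segments near \<open>z\<close>.\<close>

lemma reflected_ge_continuation:
  assumes e: "norm e = 1" and l: "0 < l" "l \<le> R" and ge: "\<And>k i. l < k \<Longrightarrow> k < R \<Longrightarrow> reflected_ge e k i"
  shows "\<forall>\<^sub>F k in at_left l. reflected_ge e k i"
proof (rule ccontr)
  have gel: "reflected_ge e l i" if "l < R" for i
    by (rule reflected_ge_closed[OF e _ that ge]) (use l in simp_all)
  assume not_ev: "\<not> (\<forall>\<^sub>F k in at_left l. reflected_ge e k i)"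
  \<comment> \<open>The lower bound 0 ensures that reflections of cap points stay in the
    ball.\<close>
  have "\<exists>k. max 0 (l - inverse (real (Suc n))) < k \<and> k < l \<and> \<not> reflected_ge e k i" for n
  proof (rule ccontr)
    assume "\<nexists>k. max 0 (l - inverse (real (Suc n))) < k \<and> k < l \<and> \<not> reflected_ge e k i"
    then have "\<And>k. k \<in> {max 0 (l - inverse (real (Suc n)))<..<l} \<Longrightarrow> reflected_ge e k i" by auto
    moreover have "\<forall>\<^sub>F k in at_left l. k \<in> {max 0 (l - inverse (real (Suc n)))<..<l}"
      using l by (intro eventually_at_left_real) simp
    ultimately show False using not_ev by (metis (no_types, lifting) eventually_mono)
  qed
  then obtain k where k: "\<And>n. max 0 (l - inverse (real (Suc n))) < k n" "\<And>n. k n < l"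
    "\<And>n. \<not> reflected_ge e (k n) i" by metis
  then obtain x where x: "\<And>n. x n \<in> ball 0 R" "\<And>n. k n < x n \<bullet> e"
    "\<And>n. u i (reflect e (k n) (x n)) < u i (x n)"
    unfolding reflected_ge_def by (metis not_le)
  have k_lim: "k \<longlonglongrightarrow> l"
  proof (rule tendsto_sandwich)
    show "(\<lambda>n. l - inverse (real (Suc n))) \<longlonglongrightarrow> l"
      using tendsto_diff[OF tendsto_const LIMSEQ_inverse_real_of_nat, of l] by simp
    show "\<forall>\<^sub>F n in sequentially. l - inverse (real (Suc n)) \<le> k n"
      using k(1) by (auto intro!: always_eventually less_imp_le)
    show "\<forall>\<^sub>F n in sequentially. k n \<le> l"
      using k(2) by (auto intro!: always_eventually less_imp_le)
  qed simp
  have "seq_compact (cball (0 :: real^'N) R)" using compact_cball compact_imp_seq_compact by blast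
  moreover have "\<And>n. x n \<in> cball 0 R" using x(1) ball_subset_cball by blast
  ultimately obtain z r where z: "z \<in> cball 0 R" and r: "strict_mono r" "(x \<circ> r) \<longlonglongrightarrow> z"
    unfolding seq_compact_def by metis
  define y where "y = x \<circ> r"
  define m where "m = k \<circ> r"
  have y_lim: "y \<longlonglongrightarrow> z" using r by (simp add: y_def)
  have m_lim: "m \<longlonglongrightarrow> l" unfolding m_def by (rule LIMSEQ_subseq_LIMSEQ[OF k_lim r(1)])
  have y: "y n \<in> ball 0 R" "m n < y n \<bullet> e" "u i (reflect e (m n) (y n)) < u i (y n)" for n
    using x by (auto simp: y_def m_def)
  have m: "0 < m n" "m n < l" for n using k by (auto simp: m_def)
  have ry: "reflect e (m n) (y n) \<in> ball 0 R" for n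
    using norm_reflect_le[OF e, of "m n" "y n"] m[of n] y[of n] by simp
  have r_lim: "(\<lambda>n. reflect e (m n) (y n)) \<longlonglongrightarrow> reflect e l z"
    unfolding reflect_def by (intro tendsto_intros y_lim m_lim)
  have z_ge: "l \<le> z \<bullet> e"
    using y(2) by (intro LIMSEQ_le[OF m_lim tendsto_inner[OF y_lim tendsto_const]])
      (auto intro: less_imp_le)
  have rz: "reflect e l z \<in> cball 0 R"
    using norm_reflect_le[OF e _ z_ge] l z by simp
  have "u i (reflect e l z) \<le> u i z"
  proof (rule LIMSEQ_le)
    show "(\<lambda>n. u i (reflect e (m n) (y n))) \<longlonglongrightarrow> u i (reflect e l z)"
      using ry by (intro continuous_on_tendsto_compose[OF cont_u r_lim rz])
        (auto intro!: always_eventually less_imp_le)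
    show "(\<lambda>n. u i (y n)) \<longlonglongrightarrow> u i z"
      using y(1) by (intro continuous_on_tendsto_compose[OF cont_u y_lim z])
        (auto intro!: always_eventually less_imp_le)
  qed (use y(3) in \<open>auto intro: less_imp_le\<close>)
  show False
  proof (cases "z \<bullet> e = l")
    case False
    then have zl: "l < z \<bullet> e" using z_ge by simp
    show False
    proof (cases "norm z = R")
      case True
      have "reflect e l z \<in> ball 0 R"
        using norm_reflect_less[OF e l(1) zl] True by simp
      then show False
        using pos[of "reflect e l z" i] bdry[OF True, of i] \<open>u i (reflect e l z) \<le> u i z\<close> by simp
    next
      case False
      then have zb: "z \<in> ball 0 R" using z by simp
      have "z \<bullet> e \<le> norm z" using norm_cauchy_schwarz[of z e] e by simp
      then have "l < R" using zl zb by simp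
      then show False
        using reflected_greater[OF e l(1) _ gel zb zl, of i] \<open>u i (reflect e l z) \<le> u i z\<close> by simp
    qed
  next
    case True
    obtain \<delta> where \<delta>: "\<delta> > 0" "\<And>y. y \<in> ball 0 R \<Longrightarrow> dist y z < \<delta> \<Longrightarrow> grad (u i) y \<bullet> e < 0"
      using grad_neg_near_plane[OF e l(1) gel z True] by blast
    have "reflect e l z = z" using True by (simp add: reflect_def)
    then have "\<forall>\<^sub>F n in sequentially. dist (y n) z < \<delta> \<and> dist (reflect e (m n) (y n)) z < \<delta>"
      using tendstoD[OF y_lim \<delta>(1)] tendstoD[OF r_lim \<delta>(1)] by (simp add: eventually_conj)
    then obtain n where n: "dist (y n) z < \<delta>" "dist (reflect e (m n) (y n)) z < \<delta>"
      using eventually_happens' sequentially_bot by blast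
    \<comment> \<open>Both ends of the segment from \<open>y n\<close> to its reflection lie in a
      convex neighbourhood where the derivative along \<open>e\<close> is negative.\<close>
    have "u i (y n) < u i (y n - (2 * (y n \<bullet> e - m n)) *\<^sub>R e)"
      using y(1,2)[of n] ry[of n] n \<delta>
      by (intro decreasing_along_segment[where S = "ball 0 R \<inter> ball z \<delta>"])
        (auto simp: reflect_def dist_commute intro: convex_Int)
    then show False using y(3)[of n] by (simp add: reflect_def)
  qed
qed

lemma reflected_ge_all:
  assumes e: "norm e = 1" and l: "0 < l" "l < R"
  shows "reflected_ge e l i"
proof -
  \<comment> \<open>\<open>S\<close> contains \<open>R\<close> vacuously. Its infimum inherits the
    ordering beyond it, and closedness followed by continuation shows that this infimum cannot be
    positive.\<close>
  define S where "S = {s. 0 \<le> s \<and> s \<le> R \<and> (\<forall>k i. s < k \<longrightarrow> k < R \<longrightarrow> reflected_ge e k i)}"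
  have RS: "R \<in> S" using R_pos by (simp add: S_def)
  have bdd: "bdd_below S" unfolding S_def by (rule bdd_belowI[of _ 0]) simp
  define s0 where "s0 = Inf S"
  have s0_le: "s0 \<le> s" if "s \<in> S" for s unfolding s0_def by (rule cInf_lower[OF that bdd])
  have s0: "0 \<le> s0" "s0 \<le> R"
    using s0_le[OF RS] RS unfolding s0_def by (auto simp: S_def intro!: cInf_greatest)
  have ge: "reflected_ge e k i" if k: "s0 < k" "k < R" for k i
  proof -
    obtain s where "s \<in> S" "s < k"
      using cInf_lessD[of S k] k(1) RS unfolding s0_def by blast
    then show ?thesis using k by (simp add: S_def)
  qed
  have "s0 = 0"
  proof (rule ccontr)
    assume "s0 \<noteq> 0"
    then have "0 < s0" using s0 by simp
    then have "\<forall>\<^sub>F k in at_left s0. \<forall>i. reflected_ge e k i"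
      using reflected_ge_continuation[OF e _ s0(2) ge] by (intro eventually_all_finite)
    then obtain d where d: "d < s0" "\<And>k i. d < k \<Longrightarrow> k < s0 \<Longrightarrow> reflected_ge e k i"
      using eventually_at_left_field[of "\<lambda>k. \<forall>i. reflected_ge e k i" s0] by blast
    have ges0: "reflected_ge e s0 i" if "s0 < R" for i
      by (rule reflected_ge_closed[OF e s0(1) that ge])
    have "reflected_ge e k i" if "d < k" "k < R" for k i
      using that d(2) ges0 ge by (cases k s0 rule: linorder_cases) auto
    \<comment> \<open>The left neighbourhood may start at a negative \<open>d\<close>.\<close>
    then have "max 0 d \<in> S"
      using s0 d(1) unfolding S_def by auto
    then show False using s0_le d \<open>0 < s0\<close> by fastforce
  qed
  then show ?thesis using ge l by simp
qed

section \<open>Radial symmetry and strict radial decrease\<close>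

lemma radial: "radial_on (cball 0 R) (u i)"
proof -
  have le: "u i x \<le> u i y" if xy: "x \<in> ball 0 R" "norm x = norm y" "x \<noteq> y" for x y
  proof -
    \<comment> \<open>The hyperplane through the origin normal to \<open>x - y\<close> exchanges
      \<open>x\<close> and \<open>y\<close>; interchanging their roles gives the opposite
      inequality.\<close>
    define e where "e = sgn (x - y)"
    have e: "norm e = 1" using xy by (simp add: e_def norm_sgn)
    have xy0: "(x + y) \<bullet> (x - y) = 0"
      using xy(2) by (simp only: norm_eq inner_add_left inner_diff_right inner_commute[of y x])
    have d: "norm (x - y) > 0" using xy by simp
    have "x \<bullet> (x - y) = (norm (x - y))\<^sup>2 / 2"
      using xy0 by (simp add: power2_norm_eq_inner inner_add_left inner_diff_left)
    then have xe: "x \<bullet> e = norm (x - y) / 2"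
      unfolding e_def sgn_div_norm inner_scaleR_right using d by (simp add: power2_eq_square field_simps)
    have "reflected_ge e 0 i"
      by (rule reflected_ge_closed[OF e _ R_pos reflected_ge_all[OF e]]) simp_all
    moreover have "0 < x \<bullet> e" using xe d by linarith
    ultimately have "u i x \<le> u i (reflect e 0 x)" using xy(1) by (simp add: reflected_ge_def)
    moreover have "reflect e 0 x = y"
      using d by (simp add: reflect_def xe) (simp add: e_def sgn_div_norm)
    ultimately show ?thesis by simp
  qed
  show ?thesis
    unfolding radial_on_def
  proof (intro ballI impI)
    fix x y :: "real^'N" assume xy: "x \<in> cball 0 R" "y \<in> cball 0 R" "norm x = norm y"
    show "u i x = u i y"
    proof (cases "norm x = R")
      case True
      then show ?thesis using bdry xy by simp
    next
      case False
      then have "x \<in> ball 0 R" "y \<in> ball 0 R" using xy by auto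
      then show ?thesis using le xy(3) by (metis order_antisym)
    qed
  qed
qed

text \<open>The hyperplane through \<open>x\<close> orthogonal to \<open>x\<close> has distance
  \<open>norm x\<close> from the origin, and the derivative along its normal is the radial
  derivative.\<close>

lemma radial_deriv_neg:
  assumes x: "0 < norm x" "norm x < R"
  shows "radial_deriv (u i) x < 0"
proof -
  define e where "e = sgn x"
  have e: "norm e = 1" using x by (simp add: e_def norm_sgn)
  have xe: "norm x *\<^sub>R e = x" using x by (simp add: e_def sgn_div_norm)
  have "x \<bullet> e = norm x" using x by (simp add: e_def sgn_div_norm dot_square_norm power2_eq_square)
  then have "grad (u i) x \<bullet> e < 0"
    using grad_neg_on_plane[OF e x reflected_ge_all[OF e x]] x by simp
  moreover have "((\<lambda>r. u i (r *\<^sub>R e)) has_real_derivative grad (u i) x \<bullet> e) (at (norm x))"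
    using twice_diff_line(1)[OF td, of 0 "norm x" e i] x xe by simp
  ultimately show ?thesis by (simp add: radial_deriv_def DERIV_imp_deriv flip: e_def)
qed

end

theorem theorem1p1:
  fixes R :: real
    and F :: "'n::finite \<Rightarrow> 'N::finite second_order"
    and f :: "'n \<Rightarrow> ('n, 'N) first_order"
    and \<alpha> \<beta> :: "'n \<Rightarrow> real" and \<gamma> :: real
    and u :: "'n \<Rightarrow> real^'N \<Rightarrow> real"
    and \<Omega> :: "(real^'N) set"
  assumes "R > 0" and "\<Omega> = ball 0 R"
    and "\<And>i. 0 < \<alpha> i" and "\<And>i. \<alpha> i \<le> \<beta> i" and "\<gamma> \<ge> 0"
    and H0: "\<And>i. orthogonally_invariant \<Omega> (F i) (f i)"
    and H1: "\<And>i. uniformly_elliptic \<Omega> (\<alpha> i) (\<beta> i) \<gamma> (F i)"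
    and H2: "\<And>i. locally_lipschitz_in_gradient \<Omega> (f i)"
    and H3: "\<And>i. radially_nonincreasing \<Omega> (F i) (f i)"
    and H4: "\<And>i. lipschitz_plus_nondecreasing_in i \<Omega> (f i)"
    and H5: "\<And>i j. j \<noteq> i \<Longrightarrow> nondecreasing_in j \<Omega> (f i)"
    and C2: "\<And>i. C2_closure \<Omega> (u i)"
    and eq: "\<And>i x. x \<in> \<Omega> \<Longrightarrow>
      F i x (grad (u i) x) (hessian (u i) x) + f i x (\<chi> j. u j x) (grad (u i) x) = 0"
    and pos: "\<And>i x. x \<in> \<Omega> \<Longrightarrow> u i x > 0"
    and bdry: "\<And>i x. x \<in> frontier \<Omega> \<Longrightarrow> u i x = 0"
  shows "\<forall>i. radial_on (closure \<Omega>) (u i) \<and>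
    (\<forall>x. 0 < norm x \<and> norm x < R \<longrightarrow> radial_deriv (u i) x < 0)"
proof -
  interpret moving_planes R F f \<alpha> \<beta> \<gamma> u
  proof unfold_locales
    show "u i x = 0" if "norm x = R" for i x
      using bdry[of x i] that assms(1,2) by simp
  qed (use assms in auto)
  show ?thesis
    using radial radial_deriv_neg assms(2) closure_ball_R by auto
qed

end
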